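(* Let $\epsilon_1,\epsilon_2,\alpha_1,\alpha_2\in(0,1]$ with $\alpha_1/n=\alpha_2/m$, let $p\in(1,n/\alpha_1)$ and $1/q=1/p-\alpha_1/n$. Let $b\in\mathrm{Lip}(\alpha_1,\alpha_2;\mathbb R^n\times\mathbb R^m)$ and let $K$ be a kernel satisfying (K1)–(K4) with exponents $\epsilon_1,\epsilon_2$, and let $[b,T]$ be the associated commutator. Then there exists a constant $C>0$, independent of $b$ and $K$, such that for all $f\in L^p(\mathbb R^n\times\mathbb R^m)$, $$\|[b,T](f)\|_{L^q(\mathbb R^n\times\mathbb R^m)}\le C\|K\|\,\|b\|_{\mathrm{Lip}(\alpha_1,\alpha_2;\mathbb R^n\times\mathbb R^m)}\|f\|_{L^p(\mathbb R^n\times\mathbb R^m)}.$$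
   Context: For $\alpha_1,\alpha_2\in(0,1]$, $\mathrm{Lip}(\alpha_1,\alpha_2;\mathbb R^n\times\mathbb R^m)$ is the set of functions $b$ on $\mathbb R^n\times\mathbb R^m$ for which there is $C$ with $|[b(x_1,x_2)-b(x_1,y_2)]-[b(y_1,x_2)-b(y_1,y_2)]|\le C|x_1-y_1|^{\alpha_1}|x_2-y_2|^{\alpha_2}$ for all $x_1,y_1\in\mathbb R^n$, $x_2,y_2\in\mathbb R^m$; the minimal such $C$ is $\|b\|_{\mathrm{Lip}(\alpha_1,\alpha_2;\mathbb R^n\times\mathbb R^m)}$. $K$ is a continuous function on $\{(x_1,y_1,x_2,y_2)\in\mathbb R^n\times\mathbb R^n\times\mathbb R^m\times\mathbb R^m: x_1\ne y_1,\ x_2\ne y_2\}$ such that for some $C$ and $\epsilon_1,\epsilon_2\in(0,1]$: (K1) $|K(x_1,y_1,x_2,y_2)|\le C|x_1-y_1|^{-n}|x_2-y_2|^{-m}$; (K2) $|K(x_1,y_1,x_2,y_2)-K(x_1,z_1,x_2,y_2)|\le C\frac{|y_1-z_1|^{\epsilon_1}}{|x_1-y_1|^{n+\epsilon_1}}\frac{1}{|x_2-y_2|^m}$ whenever $|y_1-z_1|\le|x_1-y_1|/2$; (K3) $|K(x_1,y_1,x_2,y_2)-K(x_1,y_1,x_2,z_2)|\le C\frac{1}{|x_1-y_1|^n}\frac{|y_2-z_2|^{\epsilon_2}}{|x_2-y_2|^{m+\epsilon_2}}$ whenever $|y_2-z_2|\le|x_2-y_2|/2$; (K4) $|[K(x_1,y_1,x_2,y_2)-K(x_1,z_1,x_2,y_2)]-[K(x_1,y_1,x_2,z_2)-K(x_1,z_1,x_2,z_2)]|\le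 C\frac{|y_1-z_1|^{\epsilon_1}}{|x_1-y_1|^{n+\epsilon_1}}\frac{|y_2-z_2|^{\epsilon_2}}{|x_2-y_2|^{m+\epsilon_2}}$ whenever $|y_1-z_1|\le|x_1-y_1|/2$ and $|y_2-z_2|\le|x_2-y_2|/2$. (All for $x_1\ne y_1$, $x_2\ne y_2$.) $\|K\|$ is the minimal $C$ for which (K1)–(K4) hold. The commutator is $$[b,T](f)(x_1,x_2)=\int_{\mathbb R^n\times\mathbb R^m}K(x_1,y_1,x_2,y_2)[b(x_1,x_2)-b(x_1,y_2)-b(y_1,x_2)+b(y_1,y_2)]f(y_1,y_2)\,dy_1\,dy_2.$$ *)

theory Defs
  imports "HOL-Analysis.Analysis"
begin

definition lip_cond ::
  "((real^'n) \<times> (real^'m) \<Rightarrow> real) \<Rightarrow> real \<Rightarrow> real \<Rightarrow> real \<Rightarrow> bool" where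
  "lip_cond b a1 a2 C \<longleftrightarrow>
     (\<forall>x1 y1 x2 y2.
        \<bar>(b (x1,x2) - b (x1,y2)) - (b (y1,x2) - b (y1,y2))\<bar>
          \<le> C * norm (x1 - y1) powr a1 * norm (x2 - y2) powr a2)"

definition Lip :: "real \<Rightarrow> real \<Rightarrow> ((real^'n) \<times> (real^'m) \<Rightarrow> real) set" where
  "Lip a1 a2 = {b. \<exists>C. lip_cond b a1 a2 C}"

definition lip_norm :: "((real^'n) \<times> (real^'m) \<Rightarrow> real) \<Rightarrow> real \<Rightarrow> real \<Rightarrow> real" where
  "lip_norm b a1 a2 = Inf {C. lip_cond b a1 a2 C}"

definition kernel_cond ::
  "(real^'n \<Rightarrow> real^'n \<Rightarrow> real^'m \<Rightarrow> real^'m \<Rightarrow> real) \<Rightarrow> real \<Rightarrow> real \<Rightarrow> real \<Rightarrow> bool" where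
  "kernel_cond K e1 e2 C \<longleftrightarrow>
    (let n = real CARD('n); m = real CARD('m) in
     (\<forall>x1 y1 x2 y2. x1 \<noteq> y1 \<longrightarrow> x2 \<noteq> y2 \<longrightarrow>
        \<bar>K x1 y1 x2 y2\<bar> \<le> C / (norm (x1 - y1) powr n * norm (x2 - y2) powr m)) \<and>
     (\<forall>x1 y1 z1 x2 y2. x1 \<noteq> y1 \<longrightarrow> x2 \<noteq> y2 \<longrightarrow> norm (y1 - z1) \<le> norm (x1 - y1) / 2 \<longrightarrow>
        \<bar>K x1 y1 x2 y2 - K x1 z1 x2 y2\<bar>
          \<le> C * (norm (y1 - z1) powr e1 / norm (x1 - y1) powr (n + e1))
               * (1 / norm (x2 - y2) powr m)) \<and>
     (\<forall>x1 y1 x2 y2 z2. x1 \<noteq> y1 \<longrightarrow> x2 \<noteq> y2 \<longrightarrow> norm (y2 - z2) \<le> norm (x2 - y2) / 2 \<longrightarrow>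
        \<bar>K x1 y1 x2 y2 - K x1 y1 x2 z2\<bar>
          \<le> C * (1 / norm (x1 - y1) powr n)
               * (norm (y2 - z2) powr e2 / norm (x2 - y2) powr (m + e2))) \<and>
     (\<forall>x1 y1 z1 x2 y2 z2. x1 \<noteq> y1 \<longrightarrow> x2 \<noteq> y2 \<longrightarrow>
        norm (y1 - z1) \<le> norm (x1 - y1) / 2 \<longrightarrow> norm (y2 - z2) \<le> norm (x2 - y2) / 2 \<longrightarrow>
        \<bar>(K x1 y1 x2 y2 - K x1 z1 x2 y2) - (K x1 y1 x2 z2 - K x1 z1 x2 z2)\<bar>
          \<le> C * (norm (y1 - z1) powr e1 / norm (x1 - y1) powr (n + e1))
               * (norm (y2 - z2) powr e2 / norm (x2 - y2) powr (m + e2))))"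

definition is_kernel ::
  "(real^'n \<Rightarrow> real^'n \<Rightarrow> real^'m \<Rightarrow> real^'m \<Rightarrow> real) \<Rightarrow> real \<Rightarrow> real \<Rightarrow> bool" where
  "is_kernel K e1 e2 \<longleftrightarrow>
     continuous_on {(x1, y1, x2, y2). x1 \<noteq> y1 \<and> x2 \<noteq> y2} (\<lambda>(x1, y1, x2, y2). K x1 y1 x2 y2) \<and>
     (\<exists>C. kernel_cond K e1 e2 C)"

definition kernel_norm ::
  "(real^'n \<Rightarrow> real^'n \<Rightarrow> real^'m \<Rightarrow> real^'m \<Rightarrow> real) \<Rightarrow> real \<Rightarrow> real \<Rightarrow> real" where
  "kernel_norm K e1 e2 = Inf {C. kernel_cond K e1 e2 C}"

definition commutator ::
  "((real^'n) \<times> (real^'m) \<Rightarrow> real) \<Rightarrow> (real^'n \<Rightarrow> real^'n \<Rightarrow> real^'m \<Rightarrow> real^'m \<Rightarrow> real)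
     \<Rightarrow> ((real^'n) \<times> (real^'m) \<Rightarrow> real) \<Rightarrow> (real^'n) \<times> (real^'m) \<Rightarrow> real" where
  "commutator b K f x =
     (LINT y|lebesgue. K (fst x) (fst y) (snd x) (snd y)
        * (b (fst x, snd x) - b (fst x, snd y) - b (fst y, snd x) + b (fst y, snd y)) * f y)"

definition Lp_space :: "real \<Rightarrow> ('a::euclidean_space \<Rightarrow> real) set" where
  "Lp_space p = {f. f \<in> borel_measurable lebesgue \<and> integrable lebesgue (\<lambda>x. \<bar>f x\<bar> powr p)}"

definition Lp_norm :: "real \<Rightarrow> ('a::euclidean_space \<Rightarrow> real) \<Rightarrow> real" where
  "Lp_norm p f = (LINT x|lebesgue. \<bar>f x\<bar> powr p) powr (1 / p)"

end

theory Submission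
  imports Defs
begin

text \<open>
  The size condition (K1) and the Lipschitz condition bound the commutator pointwise by \<open>\<parallel>K\<parallel> \<parallel>b\<parallel>\<close> times the product fractional integral of \<open>\<bar>f\<bar>\<close> with kernel
  \<open>\<bar>x\<^sub>1 - y\<^sub>1\<bar>\<close> to the power \<open>\<alpha>\<^sub>1 - n\<close> times \<open>\<bar>x\<^sub>2 - y\<^sub>2\<bar>\<close> to the power \<open>\<alpha>\<^sub>2 - m\<close>.
  Since \<open>\<alpha>\<^sub>1 / n = \<alpha>\<^sub>2 / m\<close>, each one-parameter fractional integral maps \<open>L\<^sup>p\<close> to the same \<open>L\<^sup>q\<close>
  by the Hardy--Littlewood--Sobolev inequality, and the two estimates are composed by means of
  Minkowski's integral inequality. The one-parameter inequality follows Hedberg: the kernel is a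
  superposition of indicators of balls; small balls are estimated by the maximal function, large
  ones by Hoelder's inequality, and one optimises over the threshold radius.
\<close>

subsection \<open>Powers and integral inequalities in the extended nonnegative reals\<close>

text \<open>All estimates are made for extended nonnegative integrals, where Tonelli's theorem and
  monotone convergence need no integrability; real integrals come back only at the very end, when
  the finite bound itself yields membership in L^q. Two measurability obstacles shape the last part.
  The function \<open>b\<close> may be wild, so regularity has to be read off its rectangular
  differences, which do not change when functions of one variable are subtracted. The function
  \<open>f\<close> is only Lebesgue measurable, so it is exchanged for a Borel representative before
  any iterated integral appears. The exponent conditions enter at two places: p > 1 pays for the
  maximal theorem, and p < n/\<alpha> makes the contribution of large balls converge. The constant
  comes from the product fractional integral alone, hence depends only on dimensions and exponents;
  \<open>b\<close> and \<open>K\<close> enter through the product of their norms.\<close>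

text \<open>Meant for positive exponents: \<open>epowr 0 p = 0\<close> and \<open>epowr \<infinity> p = \<infinity>\<close> for every \<open>p\<close>.\<close>

definition epowr :: "ennreal \<Rightarrow> real \<Rightarrow> ennreal" where
  "epowr x p = (if x = \<infinity> then \<infinity> else ennreal (enn2real x powr p))"

lemma epowr_top [simp]: "epowr \<infinity> p = \<infinity>" "epowr top p = top"
  by (auto simp: epowr_def)

lemma epowr_0 [simp]: "epowr 0 p = 0"
  by (auto simp: epowr_def)

lemma epowr_ennreal: "0 \<le> x \<Longrightarrow> epowr (ennreal x) p = ennreal (x powr p)"
  by (auto simp: epowr_def)

lemma epowr_1_left [simp]: "epowr 1 p = 1"
  using epowr_ennreal[of 1 p] by simp

lemma epowr_one [simp]: "epowr x 1 = x"
  by (cases x) (auto simp: epowr_ennreal)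

lemma epowr_mono: "x \<le> y \<Longrightarrow> 0 \<le> p \<Longrightarrow> epowr x p \<le> epowr y p"
  by (cases x; cases y) (auto simp: epowr_ennreal ennreal_le_iff intro!: powr_mono2 ennreal_leI simp: top_unique)

lemma epowr_mult:
  assumes "0 < p"
  shows "epowr (x * y) p = epowr x p * epowr y p"
proof (cases "x = 0 \<or> y = 0")
  case False
  then show ?thesis
    by (cases x; cases y)
      (auto simp: epowr_ennreal ennreal_mult_top ennreal_top_mult powr_mult simp flip: ennreal_mult)
qed auto

text \<open>Holds for exponents of either sign because 0 and infinity are fixed by every
  \<open>epowr\<close>; the same is true of \<open>epowr_add\<close>.\<close>

lemma epowr_epowr: "epowr (epowr x p) r = epowr x (p * r)"
  by (cases x) (auto simp: epowr_ennreal powr_powr)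

lemma epowr_add: "epowr x (p + r) = epowr x p * epowr x r"
  by (cases x) (auto simp: epowr_ennreal powr_add ennreal_mult)

lemma epowr_eq_0_iff [simp]: "epowr x p = 0 \<longleftrightarrow> x = 0"
  by (cases x) (auto simp: epowr_ennreal)

lemma epowr_eq_top_iff [simp]: "epowr x p = top \<longleftrightarrow> x = top"
  by (cases x) (auto simp: epowr_ennreal)

lemma borel_measurable_epowr [measurable (raw)]:
  assumes [measurable]: "f \<in> borel_measurable M"
  shows "(\<lambda>x. epowr (f x) p) \<in> borel_measurable M"
  unfolding epowr_def by measurable

section \<open>Hoelder's and Minkowski's inequalities\<close>

lemma weighted_AM_GM:
  fixes a b \<theta> :: real
  assumes "0 < \<theta>" "\<theta> < 1" "0 \<le> a" "0 \<le> b"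
  shows "a powr \<theta> * b powr (1 - \<theta>) \<le> \<theta> * a + (1 - \<theta>) * b"
proof (cases "a = 0 \<or> b = 0")
  case False
  then show ?thesis using assms Youngs_inequality_0[of \<theta> "1 - \<theta>" a b] by auto
qed (use assms in auto)

text \<open>Normalise both integrals to 1 and integrate the weighted AM-GM inequality pointwise.
  Normalising requires both integrals to be positive and finite: if one is 0, the integrand on the
  left vanishes almost everywhere, and if one is infinite and neither is 0, the right side is
  infinite.\<close>

lemma nn_integral_Holder:
  fixes F G :: "'a \<Rightarrow> ennreal"
  assumes [measurable]: "F \<in> borel_measurable M" "G \<in> borel_measurable M"
    and \<theta>: "0 < \<theta>" "\<theta> < 1"
  shows "(\<integral>\<^sup>+x. epowr (F x) \<theta> * epowr (G x) (1 - \<theta>) \<partial>M)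
    \<le> epowr (\<integral>\<^sup>+x. F x \<partial>M) \<theta> * epowr (\<integral>\<^sup>+x. G x \<partial>M) (1 - \<theta>)"
proof -
  consider "(\<integral>\<^sup>+x. F x \<partial>M) = 0 \<or> (\<integral>\<^sup>+x. G x \<partial>M) = 0"
    | "(\<integral>\<^sup>+x. F x \<partial>M) \<noteq> 0" "(\<integral>\<^sup>+x. G x \<partial>M) \<noteq> 0"
      "(\<integral>\<^sup>+x. F x \<partial>M) = \<infinity> \<or> (\<integral>\<^sup>+x. G x \<partial>M) = \<infinity>"
    | "(\<integral>\<^sup>+x. F x \<partial>M) \<noteq> 0" "(\<integral>\<^sup>+x. G x \<partial>M) \<noteq> 0"
      "(\<integral>\<^sup>+x. F x \<partial>M) \<noteq> \<infinity>" "(\<integral>\<^sup>+x. G x \<partial>M) \<noteq> \<infinity>"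
    by blast
  then show ?thesis
  proof cases
    case 1
    then have "(\<integral>\<^sup>+x. epowr (F x) \<theta> * epowr (G x) (1 - \<theta>) \<partial>M) = 0"
      by (auto simp: nn_integral_0_iff_AE)
    then show ?thesis by simp
  next
    case 2
    then have "epowr (\<integral>\<^sup>+x. F x \<partial>M) \<theta> * epowr (\<integral>\<^sup>+x. G x \<partial>M) (1 - \<theta>) = top"
      by (auto simp: ennreal_mult_eq_top_iff)
    then show ?thesis by simp
  next
    case 3
    then obtain A B where AB: "(\<integral>\<^sup>+x. F x \<partial>M) = ennreal A" "(\<integral>\<^sup>+x. G x \<partial>M) = ennreal B"
      "0 < A" "0 < B"
      by (cases "\<integral>\<^sup>+x. F x \<partial>M"; cases "\<integral>\<^sup>+x. G x \<partial>M") (auto simp: less_le)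
    \<comment> \<open>\<open>c\<close> is the right side of the claim; the pointwise bound below is
      AM-GM for u/A and v/B, multiplied by \<open>c\<close>.\<close>
    define c where "c = A powr \<theta> * B powr (1 - \<theta>)"
    have c: "0 \<le> c" by (simp add: c_def)
    have "epowr u \<theta> * epowr v (1 - \<theta>) \<le> ennreal (c * \<theta> / A) * u + ennreal (c * (1 - \<theta>) / B) * v"
      for u v
    proof (cases "u = top \<or> v = top")
      case True
      then have "ennreal (c * \<theta> / A) * u + ennreal (c * (1 - \<theta>) / B) * v = top"
        using AB \<theta> by (auto simp: ennreal_mult_eq_top_iff c_def)
      then show ?thesis by (simp only: top_greatest)
    next
      case False
      then obtain a b where ab: "u = ennreal a" "v = ennreal b" "0 \<le> a" "0 \<le> b"
        by (cases u; cases v) auto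
      have "a powr \<theta> * b powr (1 - \<theta>) = c * ((a / A) powr \<theta> * (b / B) powr (1 - \<theta>))"
        using AB ab by (simp add: c_def powr_divide)
      also have "\<dots> \<le> c * (\<theta> * (a / A) + (1 - \<theta>) * (b / B))"
        using AB ab \<theta> c by (intro mult_left_mono weighted_AM_GM) auto
      also have "\<dots> = c * \<theta> / A * a + c * (1 - \<theta>) / B * b"
        by (simp add: algebra_simps)
      finally show ?thesis
        using AB ab \<theta> c by (simp add: epowr_ennreal flip: ennreal_mult ennreal_plus)
    qed
    then have "(\<integral>\<^sup>+x. epowr (F x) \<theta> * epowr (G x) (1 - \<theta>) \<partial>M)
      \<le> (\<integral>\<^sup>+x. ennreal (c * \<theta> / A) * F x + ennreal (c * (1 - \<theta>) / B) * G x \<partial>M)"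
      by (intro nn_integral_mono) auto
    also have "\<dots> = ennreal (c * \<theta> / A) * ennreal A + ennreal (c * (1 - \<theta>) / B) * ennreal B"
      using AB by (simp add: nn_integral_add nn_integral_cmult)
    also have "\<dots> = ennreal (c * \<theta> + c * (1 - \<theta>))"
      using AB \<theta> c by (simp flip: ennreal_mult ennreal_plus)
    also have "\<dots> = ennreal c"
      by (simp add: algebra_simps)
    also have "\<dots> = epowr (\<integral>\<^sup>+x. F x \<partial>M) \<theta> * epowr (\<integral>\<^sup>+x. G x \<partial>M) (1 - \<theta>)"
      using AB by (simp add: c_def epowr_ennreal ennreal_mult)
    finally show ?thesis .
  qed
qed

text \<open>Write the s-th power as one factor times the power s - 1, expand that factor as the
  integral over y, apply Hoelder in x for each y, and cancel a power of the left side. The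
  cancellation needs a finite left side, hence the truncations \<open>H k\<close>.\<close>

lemma nn_integral_Minkowski:
  fixes g :: "'a::euclidean_space \<Rightarrow> 'b::euclidean_space \<Rightarrow> ennreal"
  assumes [measurable]: "case_prod g \<in> borel_measurable (lborel \<Otimes>\<^sub>M lborel)"
    and s: "1 < s"
  shows "epowr (\<integral>\<^sup>+x. epowr (\<integral>\<^sup>+y. g x y \<partial>lborel) s \<partial>lborel) (1 / s)
    \<le> (\<integral>\<^sup>+y. epowr (\<integral>\<^sup>+x. epowr (g x y) s \<partial>lborel) (1 / s) \<partial>lborel)"
proof -
  define G where "G x = (\<integral>\<^sup>+y. g x y \<partial>lborel)" for x
  define Y where "Y = (\<integral>\<^sup>+y. epowr (\<integral>\<^sup>+x. epowr (g x y) s \<partial>lborel) (1 / s) \<partial>lborel)"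
  \<comment> \<open>Cut off in height and in support, so that every power of \<open>H k\<close> with
    exponent s has a finite integral.\<close>
  define H where "H k x = min (G x) (of_nat k) * indicator (ball 0 (real k)) x" for k x
  have [measurable]: "G \<in> borel_measurable lborel"
    unfolding G_def by measurable
  have [measurable]: "H k \<in> borel_measurable lborel" for k
    unfolding H_def by (intro borel_measurable_times_ennreal borel_measurable_min borel_measurable_indicator) auto
  have HG: "H k x \<le> G x" for k x
    by (auto simp: H_def indicator_def)
  have bd: "(\<integral>\<^sup>+x. epowr (H k x) s \<partial>lborel) \<le> epowr Y s" for k
  proof -
    define X where "X = (\<integral>\<^sup>+x. epowr (H k x) s \<partial>lborel)"
    have "X \<le> (\<integral>\<^sup>+x. epowr (of_nat k) s * indicator (ball 0 (real k)) (x::'a) \<partial>lborel)"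
      unfolding X_def using s
      by (intro nn_integral_mono) (auto simp: H_def indicator_def intro!: epowr_mono)
    also have "\<dots> = epowr (of_nat k) s * emeasure lborel (ball (0::'a) (real k))"
      by (intro nn_integral_cmult_indicator) auto
    also have "\<dots> < \<infinity>"
      using emeasure_lborel_ball_finite[of "0::'a" "real k"]
      by (auto simp: ennreal_mult_eq_top_iff less_top[symmetric] ennreal_of_nat_eq_real_of_nat)
    finally have fin: "X < \<infinity>" .
    \<comment> \<open>Only one factor is enlarged to \<open>G\<close>; the other s - 1 stay
      truncated, so that Hoelder reproduces a power of the finite quantity \<open>X\<close>.\<close>
    have "X \<le> (\<integral>\<^sup>+x. G x * epowr (H k x) (s - 1) \<partial>lborel)"
      unfolding X_def
    proof (intro nn_integral_mono)
      fix x
      have "epowr (H k x) s = H k x * epowr (H k x) (s - 1)"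
        using epowr_add[of "H k x" 1 "s - 1"] by simp
      then show "epowr (H k x) s \<le> G x * epowr (H k x) (s - 1)"
        using HG by (auto intro: mult_right_mono)
    qed
    also have "\<dots> = (\<integral>\<^sup>+x. \<integral>\<^sup>+y. g x y * epowr (H k x) (s - 1) \<partial>lborel \<partial>lborel)"
      unfolding G_def by (simp add: nn_integral_multc)
    also have "\<dots> = (\<integral>\<^sup>+y. \<integral>\<^sup>+x. g x y * epowr (H k x) (s - 1) \<partial>lborel \<partial>lborel)"
      by (intro lborel_pair.Fubini'[symmetric]) measurable
    also have "\<dots> \<le> (\<integral>\<^sup>+y. epowr (\<integral>\<^sup>+x. epowr (g x y) s \<partial>lborel) (1 / s) * epowr X (1 - 1 / s) \<partial>lborel)"
    proof (intro nn_integral_mono)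
      fix y :: 'b
      have "(\<integral>\<^sup>+x. g x y * epowr (H k x) (s - 1) \<partial>lborel)
        = (\<integral>\<^sup>+x. epowr (epowr (g x y) s) (1/s) * epowr (epowr (H k x) s) (1 - 1/s) \<partial>lborel)"
        using s by (simp add: epowr_epowr algebra_simps)
      also have "\<dots> \<le> epowr (\<integral>\<^sup>+x. epowr (g x y) s \<partial>lborel) (1 / s) * epowr X (1 - 1 / s)"
        unfolding X_def using s by (intro nn_integral_Holder) auto
      finally show "(\<integral>\<^sup>+x. g x y * epowr (H k x) (s - 1) \<partial>lborel)
        \<le> epowr (\<integral>\<^sup>+x. epowr (g x y) s \<partial>lborel) (1 / s) * epowr X (1 - 1 / s)" .
    qed
    also have "\<dots> = Y * epowr X (1 - 1 / s)"
      unfolding Y_def by (simp add: nn_integral_multc)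
    finally have le: "X \<le> Y * epowr X (1 - 1 / s)" .
    have "X \<le> epowr Y s"
    proof (cases "X = 0 \<or> Y = top")
      case False
      then obtain a b where ab: "X = ennreal a" "Y = ennreal b" "0 < a" "0 \<le> b"
        using fin by (cases X; cases Y) (auto simp: less_le)
      have "a \<le> b * a powr (1 - 1/s)"
        using le ab by (simp add: epowr_ennreal flip: ennreal_mult)
      then have "a powr (1/s) \<le> b"
        using ab by (simp add: powr_diff field_simps)
      then have "(a powr (1/s)) powr s \<le> b powr s"
        using s ab by (intro powr_mono2) auto
      then show ?thesis using ab s by (simp add: powr_powr epowr_ennreal)
    qed auto
    then show ?thesis by (simp add: X_def)
  qed
  \<comment> \<open>Where \<open>G x\<close> is finite the truncations become stationary. Where it
    is infinite, \<open>H k x = k\<close> for large k, and k is at most its s-th power because k is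
    at least 1.\<close>
  have sup: "epowr (G x) s \<le> (SUP k. epowr (H k x) s)" for x
  proof -
    obtain k0 :: nat where k0: "norm x < real k0" "1 \<le> k0"
      using reals_Archimedean2[of "max (norm x) 1"] by auto
    show ?thesis
    proof (cases "G x")
      case (real r)
      obtain k1 :: nat where k1: "r < real k1" using reals_Archimedean2 by blast
      have "H (max k0 k1) x = G x"
        using k0 k1 real
        by (auto simp: H_def indicator_def min_def simp flip: ennreal_of_nat_eq_real_of_nat)
      then have "epowr (G x) s = epowr (H (max k0 k1) x) s" by simp
      also have "\<dots> \<le> (SUP k. epowr (H k x) s)" by (intro SUP_upper) auto
      finally show ?thesis .
    next
      case top
      have "of_nat n \<le> (SUP k. epowr (H k x) s)" for n :: nat
      proof -
        define k where "k = max k0 n"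
        have k: "1 \<le> real k" "norm x < real k" using k0 by (auto simp: k_def)
        have "of_nat n \<le> ennreal (real k)"
          by (simp add: k_def ennreal_of_nat_eq_real_of_nat)
        also have "\<dots> \<le> ennreal (real k powr s)"
          using k s powr_mono[of 1 s "real k"] by (intro ennreal_leI) auto
        also have "\<dots> = epowr (H k x) s"
          using k top by (simp add: H_def ennreal_of_nat_eq_real_of_nat epowr_ennreal)
        also have "\<dots> \<le> (SUP k. epowr (H k x) s)" by (intro SUP_upper) auto
        finally show ?thesis .
      qed
      then have "(SUP k. epowr (H k x) s) = top"
        by (metis ennreal_SUP_of_nat_eq_top SUP_least top_unique)
      then show ?thesis by (simp only: top_greatest)
    qed
  qed
  have "(\<integral>\<^sup>+x. epowr (G x) s \<partial>lborel) \<le> (\<integral>\<^sup>+x. (SUP k. epowr (H k x) s) \<partial>lborel)"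
    using sup by (intro nn_integral_mono)
  also have "\<dots> = (SUP k. (\<integral>\<^sup>+x. epowr (H k x) s \<partial>lborel))"
  proof (intro nn_integral_monotone_convergence_SUP)
    show "incseq (\<lambda>k x. epowr (H k x) s)"
      using s by (auto simp: incseq_def le_fun_def H_def indicator_def intro!: epowr_mono min.mono)
  qed auto
  also have "\<dots> \<le> epowr Y s" using bd by (intro SUP_least)
  finally have "epowr (\<integral>\<^sup>+x. epowr (G x) s \<partial>lborel) (1 / s) \<le> epowr (epowr Y s) (1/s)"
    using s by (intro epowr_mono) auto
  then show ?thesis using s by (simp add: G_def Y_def epowr_epowr)
qed

subsection \<open>The uncentred maximal function\<close>

text \<open>At a point of the union the counting integral of the indicators is at least 1; integrate
  and exchange the integrals. The index set is arbitrary countable because Vitali's lemma selects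
  balls without enumerating them.\<close>

lemma emeasure_UN_countable_le:
  assumes [measurable]: "\<And>i. i \<in> I \<Longrightarrow> X i \<in> sets M" and "countable I"
  shows "emeasure M (\<Union>i\<in>I. X i) \<le> (\<integral>\<^sup>+i. emeasure M (X i) \<partial>count_space I)"
proof -
  have [measurable]: "(\<Union>i\<in>I. X i) \<in> sets M"
    using assms by (intro sets.countable_UN') auto
  have "emeasure M (\<Union>i\<in>I. X i) = (\<integral>\<^sup>+x. indicator (\<Union>i\<in>I. X i) x \<partial>M)"
    by simp
  also have "\<dots> \<le> (\<integral>\<^sup>+x. \<integral>\<^sup>+i. indicator (X i) x \<partial>count_space I \<partial>M)"
  proof (intro nn_integral_mono)
    fix x
    show "indicator (\<Union>i\<in>I. X i) x \<le> (\<integral>\<^sup>+i. indicator (X i) x \<partial>count_space I :: ennreal)"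
    proof (cases "x \<in> (\<Union>i\<in>I. X i)")
      case True
      then obtain j where "j \<in> I" "x \<in> X j" by auto
      then show ?thesis
        using nn_integral_ge_point[of j I "\<lambda>i. indicator (X i) x"] True by (simp add: indicator_def)
    qed auto
  qed
  also have "\<dots> = (\<integral>\<^sup>+i. \<integral>\<^sup>+x. indicator (X i) x \<partial>M \<partial>count_space I)"
    using assms by (intro nn_integral_count_space_nn_integral) auto
  also have "\<dots> = (\<integral>\<^sup>+i. emeasure M (X i) \<partial>count_space I)"
    by (intro nn_integral_cong) auto
  finally show ?thesis .
qed

text \<open>The inner integral of the layer-cake formula. Allowing \<open>X\<close> to be infinite
  avoids having to know beforehand that the maximal function is finite.\<close>

lemma nn_integral_powr_less:
  assumes c: "0 < c"
  shows "(\<integral>\<^sup>+s. (if 0 < s \<and> ennreal s < X then ennreal (s powr (c - 1)) else 0) \<partial>lborel)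
    = ennreal (1 / c) * epowr X c" (is "?I X = _")
proof -
  have fin: "?I (ennreal b) = ennreal (b powr c / c)" if "0 \<le> b" for b
  proof -
    have "((\<lambda>s. s powr (c - 1)) has_integral (b powr c / c)) {0..b}"
      using has_integral_powr_from_0[of "c - 1" b] c that by simp
    then have "(\<integral>\<^sup>+s. ennreal (indicator {0..b} s * s powr (c - 1)) \<partial>lborel) = ennreal (b powr c / c)"
      by (intro nn_integral_has_integral_lebesgue) auto
    moreover have "?I (ennreal b) = (\<integral>\<^sup>+s. ennreal (indicator {0..b} s * s powr (c - 1)) \<partial>lborel)"
    proof (intro nn_integral_cong_AE)
      show "AE s in lborel. (if 0 < s \<and> ennreal s < ennreal b then ennreal (s powr (c - 1)) else 0)
        = ennreal (indicator {0..b} s * s powr (c - 1))"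
        using AE_lborel_singleton[of "0::real"] AE_lborel_singleton[of b]
        by eventually_elim (auto simp: indicator_def ennreal_less_iff)
    qed
    ultimately show ?thesis by simp
  qed
  show ?thesis
  proof (cases X)
    case (real b)
    then show ?thesis using fin[of b] c by (simp add: epowr_ennreal ennreal_mult[symmetric])
  next
    case top
    have "?I X = top"
    proof (cases "?I X")
      case (real r)
      \<comment> \<open>Chosen so that the integral up to \<open>b\<close> is r + 1, more than the
        supposed finite value \<open>r\<close> of the whole integral.\<close>
      define b where "b = (c * (r + 1)) powr (1 / c)"
      have "ennreal (b powr c / c) = ?I (ennreal b)" using fin[of b] by (simp add: b_def)
      also have "\<dots> \<le> ?I X" using top by (intro nn_integral_mono) (auto simp: less_top[symmetric])
      also have "\<dots> = ennreal r" by (rule real)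
      finally have "b powr c / c \<le> r" using real by (simp add: ennreal_le_iff)
      moreover have "b powr c / c = r + 1"
        using c real by (simp add: b_def powr_powr)
      ultimately show ?thesis by simp
    qed
    then show ?thesis using top c by (simp add: ennreal_mult_eq_top_iff)
  qed
qed

section \<open>Volumes of balls, the maximal operator, and its weak and strong type bounds\<close>

lemma emeasure_ball_powr:
  fixes c :: "'a::euclidean_space"
  assumes "0 < r"
  shows "emeasure lborel (ball c r) = ennreal (unit_ball_vol (real DIM('a)) * r powr real DIM('a))"
  using assms by (simp add: emeasure_ball powr_realpow)

lemma emeasure_ball_pos_finite:
  fixes c :: "'a::euclidean_space"
  assumes "0 < r"
  shows "emeasure lborel (ball c r) \<noteq> 0" "emeasure lborel (ball c r) \<noteq> top"
  using assms unit_ball_vol_pos[of "real DIM('a)"]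
  by (auto simp: emeasure_ball_powr simp del: unit_ball_vol_pos)

text \<open>All balls containing x compete, not only those centred at x. Superlevel sets are then
  unions of balls, so they are open and measurability holds for every \<open>f\<close>.\<close>

definition maximal :: "('a::euclidean_space \<Rightarrow> ennreal) \<Rightarrow> 'a \<Rightarrow> ennreal" where
  "maximal f x = (SUP (c, r) \<in> {(c, r). x \<in> ball c r}.
     (\<integral>\<^sup>+y\<in>ball c r. f y \<partial>lborel) / emeasure lborel (ball c r))"

lemma nn_integral_ball_le_maximal:
  assumes "x \<in> ball c r"
  shows "(\<integral>\<^sup>+y\<in>ball c r. f y \<partial>lborel) \<le> emeasure lborel (ball c r) * maximal f x"
proof -
  have r: "0 < r" using assms zero_le_dist[of c x] by (auto simp del: zero_le_dist)
  have e: "emeasure lborel (ball c r) \<noteq> 0" "emeasure lborel (ball c r) \<noteq> top"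
    using emeasure_ball_pos_finite[OF r] by auto
  have "(\<integral>\<^sup>+y\<in>ball c r. f y \<partial>lborel)
    = emeasure lborel (ball c r) * ((\<integral>\<^sup>+y\<in>ball c r. f y \<partial>lborel) / emeasure lborel (ball c r))"
    using mult_divide_eq_ennreal[OF e, of "\<integral>\<^sup>+y\<in>ball c r. f y \<partial>lborel"]
    by (simp add: ennreal_times_divide mult.commute[of "emeasure lborel (ball c r)"])
  also have "\<dots> \<le> emeasure lborel (ball c r) * maximal f x"
    unfolding maximal_def using assms
    by (intro mult_left_mono SUP_upper2[of "(c, r)"]) auto
  finally show ?thesis .
qed

lemma maximal_level_set:
  "{x. t < maximal f x} = (\<Union>(c, r)\<in>{(c, r). 0 < r \<and>
     t < (\<integral>\<^sup>+y\<in>ball c r. f y \<partial>lborel) / emeasure lborel (ball c r)}. ball c r)" (is "?L = ?R")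
proof (intro set_eqI iffI)
  fix x assume "x \<in> ?L"
  then obtain c r where "x \<in> ball c r"
      "t < (\<integral>\<^sup>+y\<in>ball c r. f y \<partial>lborel) / emeasure lborel (ball c r)"
    by (auto simp: maximal_def less_SUP_iff)
  moreover from this have "0 < r" using zero_le_dist[of c x] by (auto simp del: zero_le_dist)
  ultimately show "x \<in> ?R" by auto
next
  fix x assume "x \<in> ?R"
  then obtain c r where "x \<in> ball c r"
      "t < (\<integral>\<^sup>+y\<in>ball c r. f y \<partial>lborel) / emeasure lborel (ball c r)"
    by auto
  then show "x \<in> ?L"
    by (auto simp: maximal_def less_SUP_iff)
qed

lemma open_maximal_level_set: "open {x. t < maximal f x}"
  unfolding maximal_level_set by auto

lemma borel_measurable_maximal [measurable]: "maximal f \<in> borel_measurable borel"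
  by (rule borel_measurableI_greater) (auto intro!: borel_open open_maximal_level_set)

text \<open>The level set is covered by balls on which the average of \<open>f\<close> exceeds t.
  Vitali's lemma extracts a disjoint subfamily whose fivefold dilates still cover; dilation costs 5
  to the dimension, and disjointness bounds the sum of the integrals by the full integral.\<close>

lemma maximal_weak_type:
  fixes f :: "'a::euclidean_space \<Rightarrow> ennreal"
  assumes [measurable]: "f \<in> borel_measurable borel" and t: "0 < t"
  shows "ennreal t * emeasure lborel {x. ennreal t < maximal f x} \<le> 5 ^ DIM('a) * (\<integral>\<^sup>+y. f y \<partial>lborel)"
proof (cases "\<integral>\<^sup>+y. f y \<partial>lborel")
  case top
  then show ?thesis by (simp add: ennreal_mult_eq_top_iff)
next
  case (real I)
  define v where "v = unit_ball_vol (real DIM('a))"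
  have v: "0 < v" by (simp add: v_def)
  define K where "K = {(c::'a, r). 0 < r \<and>
     ennreal t < (\<integral>\<^sup>+y\<in>ball c r. f y \<partial>lborel) / emeasure lborel (ball c r)}"
  have K: "0 < r" "ennreal t * emeasure lborel (ball c r) \<le> (\<integral>\<^sup>+y\<in>ball c r. f y \<partial>lborel)"
    if "(c, r) \<in> K" for c r
  proof -
    show r: "0 < r" using that by (simp add: K_def)
    have e: "emeasure lborel (ball c r) \<noteq> 0" "emeasure lborel (ball c r) \<noteq> top"
      using emeasure_ball_pos_finite[OF r] by auto
    have "ennreal t * emeasure lborel (ball c r)
      \<le> (\<integral>\<^sup>+y\<in>ball c r. f y \<partial>lborel) / emeasure lborel (ball c r) * emeasure lborel (ball c r)"
      using that by (intro mult_right_mono) (auto simp: K_def)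
    also have "\<dots> = (\<integral>\<^sup>+y\<in>ball c r. f y \<partial>lborel)"
      using e by (simp add: ennreal_divide_times ennreal_divide_self less_top[symmetric])
    finally show "ennreal t * emeasure lborel (ball c r) \<le> (\<integral>\<^sup>+y\<in>ball c r. f y \<partial>lborel)" .
  qed
  \<comment> \<open>Vitali's lemma needs bounded radii. A ball of \<open>K\<close> has volume at
    most I/t, and for r > 1 the radius is at most its power of order the dimension.\<close>
  have bounded: "r \<le> max 1 (I / (t * v))" if "(c, r) \<in> K" for c r
  proof (cases "r \<le> 1")
    case False
    have "ennreal (t * (v * r ^ DIM('a))) = ennreal t * emeasure lborel (ball c r)"
      using K(1)[OF that] t v by (simp add: emeasure_ball v_def ennreal_mult)
    also have "\<dots> \<le> (\<integral>\<^sup>+y\<in>ball c r. f y \<partial>lborel)" using K(2)[OF that] .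
    also have "\<dots> \<le> (\<integral>\<^sup>+y. f y \<partial>lborel)" by (intro nn_integral_mono) (auto simp: indicator_def)
    finally have "t * (v * r ^ DIM('a)) \<le> I" using real by (simp add: ennreal_le_iff)
    then have "r ^ DIM('a) \<le> I / (t * v)" using t v by (simp add: field_simps)
    moreover have "r \<le> r ^ DIM('a)" using False DIM_positive[where 'a='a]
      by (intro self_le_power) auto
    ultimately show ?thesis by simp
  qed auto
  obtain C where C: "countable C" "C \<subseteq> K"
     "pairwise (\<lambda>i j. disjnt (ball (fst i) (snd i)) (ball (fst j) (snd j))) C"
     "{x. ennreal t < maximal f x} \<subseteq> (\<Union>i\<in>C. ball (fst i) (5 * snd i))"
  proof (rule Vitali_covering_lemma_balls[where S="{x. ennreal t < maximal f x}" and K=K and a=fst and r=snd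
      and B="max 1 (I / (t * v))"])
    show "{x. ennreal t < maximal f x} \<subseteq> (\<Union>i\<in>K. ball (fst i) (snd i))"
      unfolding maximal_level_set K_def by auto
  qed (use K(1) bounded in auto)
  have Cpos: "0 < snd i" if "i \<in> C" for i
    using C(2) K(1)[of "fst i" "snd i"] that by auto
  have disj: "disjoint_family_on (\<lambda>i. ball (fst i) (snd i)) C"
    using C(3) by (auto simp: disjoint_family_on_def pairwise_def disjnt_def)
  have "ennreal t * emeasure lborel {x. ennreal t < maximal f x}
    \<le> ennreal t * emeasure lborel (\<Union>i\<in>C. ball (fst i) (5 * snd i))"
    using C(4) by (intro mult_left_mono emeasure_mono) (auto intro!: borel_open)
  also have "\<dots> \<le> ennreal t * (\<integral>\<^sup>+i. emeasure lborel (ball (fst i) (5 * snd i)) \<partial>count_space C)"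
    using C(1) by (intro mult_left_mono emeasure_UN_countable_le) auto
  also have "\<dots> = ennreal t * (\<integral>\<^sup>+i. 5 ^ DIM('a) * emeasure lborel (ball (fst i) (snd i)) \<partial>count_space C)"
  proof (intro arg_cong2[where f="(*)"] refl nn_integral_cong)
    fix i assume "i \<in> space (count_space C)"
    then have "0 < snd i" using Cpos by simp
    moreover have "(5::ennreal) ^ DIM('a) = ennreal (5 ^ DIM('a))"
      by (simp flip: ennreal_power)
    ultimately show "emeasure lborel (ball (fst i) (5 * snd i)) = 5 ^ DIM('a) * emeasure lborel (ball (fst i) (snd i))"
      by (simp add: emeasure_ball power_mult_distrib mult_ac flip: ennreal_mult)
  qed
  also have "\<dots> = 5 ^ DIM('a) * (\<integral>\<^sup>+i. ennreal t * emeasure lborel (ball (fst i) (snd i)) \<partial>count_space C)"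
    by (simp add: nn_integral_cmult mult_ac)
  \<comment> \<open>With the ball integrals read as values of the measure with density
    \<open>f\<close>, countable additivity sums them over the disjoint family.\<close>
  also have "\<dots> \<le> 5 ^ DIM('a) * (\<integral>\<^sup>+i. emeasure (density lborel f) (ball (fst i) (snd i)) \<partial>count_space C)"
    using C(2) K(2) by (intro mult_left_mono nn_integral_mono) (auto simp: emeasure_density)
  also have "(\<integral>\<^sup>+i. emeasure (density lborel f) (ball (fst i) (snd i)) \<partial>count_space C)
    = emeasure (density lborel f) (\<Union>i\<in>C. ball (fst i) (snd i))"
    using C(1) disj by (intro emeasure_UN_countable[symmetric]) auto
  also have "\<dots> \<le> emeasure (density lborel f) (space lborel)"
    by (intro emeasure_mono) auto
  also have "\<dots> = (\<integral>\<^sup>+y. f y \<partial>lborel)"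
    by (simp add: emeasure_density)
  finally show ?thesis by (simp add: mult_left_mono)
qed

text \<open>The average of a constant is that constant. This allows \<open>f\<close> to be cut at a
  height: the part below it raises the maximal function by no more than the height.\<close>

lemma maximal_add_const_le:
  fixes f :: "'a::euclidean_space \<Rightarrow> ennreal"
  assumes [measurable]: "g \<in> borel_measurable borel" and le: "\<And>x. f x \<le> g x + t"
  shows "maximal f x \<le> maximal g x + t"
  unfolding maximal_def[of f]
proof (intro SUP_least, clarsimp simp del: mem_ball)
  fix c :: 'a and r
  assume x: "x \<in> ball c r"
  then have r: "0 < r" using zero_le_dist[of c x] by (auto simp del: zero_le_dist)
  have e: "emeasure lborel (ball c r) \<noteq> 0" "emeasure lborel (ball c r) \<noteq> top"
    using emeasure_ball_pos_finite[OF r] by auto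
  have "(\<integral>\<^sup>+y\<in>ball c r. f y \<partial>lborel) \<le> (\<integral>\<^sup>+y. g y * indicator (ball c r) y + t * indicator (ball c r) y \<partial>lborel)"
    using le by (intro nn_integral_mono) (auto simp: indicator_def)
  also have "\<dots> = (\<integral>\<^sup>+y\<in>ball c r. g y \<partial>lborel) + t * emeasure lborel (ball c r)"
    by (subst nn_integral_add)
      (auto simp: nn_integral_cmult_indicator intro!: borel_measurable_times_ennreal borel_measurable_indicator)
  also have "\<dots> \<le> (maximal g x + t) * emeasure lborel (ball c r)"
    using nn_integral_ball_le_maximal[OF x, of g]
    by (auto simp: distrib_right mult.commute intro: add_mono)
  finally have "(\<integral>\<^sup>+y\<in>ball c r. f y \<partial>lborel) / emeasure lborel (ball c r)
    \<le> (maximal g x + t) * emeasure lborel (ball c r) / emeasure lborel (ball c r)"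
    by (intro divide_right_mono_ennreal)
  then show "(\<integral>\<^sup>+y\<in>ball c r. f y \<partial>lborel) / emeasure lborel (ball c r) \<le> maximal g x + t"
    using e by (simp add: mult_divide_eq_ennreal)
qed

text \<open>Marcinkiewicz interpolation: at height s only the part of \<open>f\<close> above s/2 can
  push the maximal function over s, so the weak type bound is applied to that part at height s/2 and
  integrated over s. In the constant, p comes from the layer-cake formula, the power of 5 from the
  weak type bound, one factor 2 from halving the height, and the rest from integrating s to the
  power p - 2 up to \<open>2 * f x\<close>.\<close>

lemma maximal_strong_type:
  fixes f :: "'a::euclidean_space \<Rightarrow> ennreal"
  assumes [measurable]: "f \<in> borel_measurable borel" and p: "1 < p"
  shows "(\<integral>\<^sup>+x. epowr (maximal f x) p \<partial>lborel)
    \<le> ennreal (p * 5 ^ DIM('a) * 2 powr p / (p - 1)) * (\<integral>\<^sup>+x. epowr (f x) p \<partial>lborel)"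
proof -
  define A :: real where "A = 5 ^ DIM('a)"
  have A: "0 < A" "(5::ennreal) ^ DIM('a) = ennreal A"
    by (auto simp: A_def simp flip: ennreal_power)
  have weak: "ennreal (s powr (p - 1)) * emeasure lborel {x. ennreal s < maximal f x}
    \<le> ennreal (2 * A) * (\<integral>\<^sup>+x. (if ennreal s < 2 * f x then f x * ennreal (s powr (p - 2)) else 0) \<partial>lborel)"
    if s: "0 < s" for s
  proof -
    define g where "g x = (if ennreal s < 2 * f x then f x else 0)" for x
    have [measurable]: "g \<in> borel_measurable borel" unfolding g_def by measurable
    have "f x \<le> g x + ennreal (s / 2)" for x
    proof (cases "ennreal s < 2 * f x")
      case False
      then have "2 * f x \<le> ennreal s" by simp
      then have "f x \<le> ennreal (s / 2)"
        by (cases "f x") (use s in \<open>auto simp: ennreal_le_iff ennreal_mult_eq_top_iff top_unique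
          simp flip: ennreal_numeral ennreal_mult\<close>)
      then show ?thesis by (simp add: g_def False)
    qed (simp add: g_def)
    then have le: "maximal f x \<le> maximal g x + ennreal (s / 2)" for x
      by (intro maximal_add_const_le) auto
    have sub: "{x. ennreal s < maximal f x} \<subseteq> {x. ennreal (s / 2) < maximal g x}"
    proof safe
      fix x assume "ennreal s < maximal f x"
      also note le[of x]
      finally have "ennreal (s / 2) + ennreal (s / 2) < maximal g x + ennreal (s / 2)"
        using s by (simp flip: ennreal_plus)
      then show "ennreal (s / 2) < maximal g x"
        by (metis add_right_mono not_le)
    qed
    \<comment> \<open>Splits off the factor s/2 that the weak type bound at height s/2
      consumes.\<close>
    have "ennreal (s powr (p - 1)) * emeasure lborel {x. ennreal s < maximal f x}
      = ennreal (2 * s powr (p - 2)) * (ennreal (s / 2) * emeasure lborel {x. ennreal s < maximal f x})"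
    proof -
      have "s powr (p - 1) = 2 * s powr (p - 2) * (s / 2)"
        using s by (simp add: powr_diff field_simps power2_eq_square)
      then have "ennreal (s powr (p - 1)) = ennreal (2 * s powr (p - 2)) * ennreal (s / 2)"
        using s by (subst ennreal_mult[symmetric]) auto
      then show ?thesis by (simp only: mult.assoc)
    qed
    also have "\<dots> \<le> ennreal (2 * s powr (p - 2)) * (ennreal (s / 2) * emeasure lborel {x. ennreal (s / 2) < maximal g x})"
      using sub by (intro mult_left_mono emeasure_mono) auto
    also have "\<dots> \<le> ennreal (2 * s powr (p - 2)) * (ennreal A * (\<integral>\<^sup>+y. g y \<partial>lborel))"
      using maximal_weak_type[of g "s / 2"] s unfolding A by (intro mult_left_mono) auto
    also have "\<dots> = ennreal (2 * A) * (\<integral>\<^sup>+y. g y * ennreal (s powr (p - 2)) \<partial>lborel)"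
      using A by (simp add: nn_integral_multc ennreal_mult mult_ac)
    also have "(\<lambda>y. g y * ennreal (s powr (p - 2)))
      = (\<lambda>x. if ennreal s < 2 * f x then f x * ennreal (s powr (p - 2)) else 0)"
      by (auto simp: g_def)
    finally show ?thesis .
  qed
  have "(\<integral>\<^sup>+x. epowr (maximal f x) p \<partial>lborel)
    = (\<integral>\<^sup>+x. ennreal p * (\<integral>\<^sup>+s. (if 0 < s \<and> ennreal s < maximal f x then ennreal (s powr (p - 1)) else 0) \<partial>lborel) \<partial>lborel)"
  proof (intro nn_integral_cong)
    fix x
    show "epowr (maximal f x) p
      = ennreal p * (\<integral>\<^sup>+s. (if 0 < s \<and> ennreal s < maximal f x then ennreal (s powr (p - 1)) else 0) \<partial>lborel)"
      using p by (subst nn_integral_powr_less) (auto simp: mult.assoc[symmetric] simp flip: ennreal_mult)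
  qed
  also have "\<dots> = ennreal p * (\<integral>\<^sup>+x. \<integral>\<^sup>+s. (if 0 < s \<and> ennreal s < maximal f x then ennreal (s powr (p - 1)) else 0) \<partial>lborel \<partial>lborel)"
    by (subst nn_integral_cmult) auto
  also have "(\<integral>\<^sup>+x. \<integral>\<^sup>+s. (if 0 < s \<and> ennreal s < maximal f x then ennreal (s powr (p - 1)) else 0) \<partial>lborel \<partial>lborel)
    = (\<integral>\<^sup>+s. \<integral>\<^sup>+x. (if 0 < s \<and> ennreal s < maximal f x then ennreal (s powr (p - 1)) else 0) \<partial>lborel \<partial>lborel)"
    by (intro lborel_pair.Fubini'[symmetric]) measurable
  also have "\<dots> \<le> (\<integral>\<^sup>+s. ennreal (2 * A) *
    (\<integral>\<^sup>+x. (if 0 < s \<and> ennreal s < 2 * f x then f x * ennreal (s powr (p - 2)) else 0) \<partial>lborel) \<partial>lborel)"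
  proof (intro nn_integral_mono)
    fix s :: real
    show "(\<integral>\<^sup>+x. (if 0 < s \<and> ennreal s < maximal f x then ennreal (s powr (p - 1)) else 0) \<partial>lborel)
      \<le> ennreal (2 * A) * (\<integral>\<^sup>+x. (if 0 < s \<and> ennreal s < 2 * f x then f x * ennreal (s powr (p - 2)) else 0) \<partial>lborel)"
    proof (cases "0 < s")
      case True
      have "(\<integral>\<^sup>+x. (if 0 < s \<and> ennreal s < maximal f x then ennreal (s powr (p - 1)) else 0) \<partial>lborel)
        = (\<integral>\<^sup>+x. ennreal (s powr (p - 1)) * indicator {x. ennreal s < maximal f x} x \<partial>lborel)"
        using True by (intro nn_integral_cong) (auto simp: indicator_def)
      also have "\<dots> = ennreal (s powr (p - 1)) * emeasure lborel {x. ennreal s < maximal f x}"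
        by (intro nn_integral_cmult_indicator) (auto intro!: borel_open open_maximal_level_set)
      finally show ?thesis using weak[OF True] True by simp
    qed simp
  qed
  also have "\<dots> = ennreal (2 * A) * (\<integral>\<^sup>+s. \<integral>\<^sup>+x. (if 0 < s \<and> ennreal s < 2 * f x then f x * ennreal (s powr (p - 2)) else 0) \<partial>lborel \<partial>lborel)"
    by (subst nn_integral_cmult) auto
  also have "(\<integral>\<^sup>+s. \<integral>\<^sup>+x. (if 0 < s \<and> ennreal s < 2 * f x then f x * ennreal (s powr (p - 2)) else 0) \<partial>lborel \<partial>lborel)
    = (\<integral>\<^sup>+x. \<integral>\<^sup>+s. (if 0 < s \<and> ennreal s < 2 * f x then f x * ennreal (s powr (p - 2)) else 0) \<partial>lborel \<partial>lborel)"
    by (intro lborel_pair.Fubini') measurable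
  also have "\<dots> = (\<integral>\<^sup>+x. ennreal (2 powr (p - 1) / (p - 1)) * epowr (f x) p \<partial>lborel)"
  proof (intro nn_integral_cong)
    fix x
    \<comment> \<open>The exponent is rewritten as \<open>p - 1 - 1\<close> so that the layer-cake
      integral applies with c = p - 1, which is positive since p > 1.\<close>
    have "(\<integral>\<^sup>+s. (if 0 < s \<and> ennreal s < 2 * f x then f x * ennreal (s powr (p - 2)) else 0) \<partial>lborel)
      = (\<integral>\<^sup>+s. f x * (if 0 < s \<and> ennreal s < 2 * f x then ennreal (s powr (p - 1 - 1)) else 0) \<partial>lborel)"
      by (intro nn_integral_cong) auto
    also have "\<dots> = f x * (\<integral>\<^sup>+s. (if 0 < s \<and> ennreal s < 2 * f x then ennreal (s powr (p - 1 - 1)) else 0) \<partial>lborel)"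
      by (intro nn_integral_cmult) auto
    also have "\<dots> = f x * (ennreal (1 / (p - 1)) * epowr (2 * f x) (p - 1))"
      using p by (subst nn_integral_powr_less) auto
    also have "\<dots> = ennreal (1 / (p - 1)) * epowr 2 (p - 1) * (f x * epowr (f x) (p - 1))"
      using p by (simp add: epowr_mult mult_ac)
    also have "epowr 2 (p - 1) = ennreal (2 powr (p - 1))"
      using epowr_ennreal[of 2 "p - 1"] by simp
    also have "f x * epowr (f x) (p - 1) = epowr (f x) p"
      using epowr_add[of "f x" 1 "p - 1"] by simp
    finally show "(\<integral>\<^sup>+s. (if 0 < s \<and> ennreal s < 2 * f x then f x * ennreal (s powr (p - 2)) else 0) \<partial>lborel)
      = ennreal (2 powr (p - 1) / (p - 1)) * epowr (f x) p"
      using p by (simp flip: ennreal_mult)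
  qed
  also have "\<dots> = ennreal (2 powr (p - 1) / (p - 1)) * (\<integral>\<^sup>+x. epowr (f x) p \<partial>lborel)"
    by (intro nn_integral_cmult) auto
  finally have "(\<integral>\<^sup>+x. epowr (maximal f x) p \<partial>lborel)
    \<le> ennreal p * (ennreal (2 * A) * (ennreal (2 powr (p - 1) / (p - 1)) * (\<integral>\<^sup>+x. epowr (f x) p \<partial>lborel)))"
    by (simp add: mult_left_mono)
  also have "\<dots> = ennreal (p * (2 * A) * (2 powr (p - 1) / (p - 1))) * (\<integral>\<^sup>+x. epowr (f x) p \<partial>lborel)"
  proof -
    have "ennreal (p * (2 * A) * (2 powr (p - 1) / (p - 1)))
      = ennreal p * ennreal (2 * A) * ennreal (2 powr (p - 1) / (p - 1))"
      using p A by (subst ennreal_mult, simp, simp, subst ennreal_mult) auto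
    then show ?thesis by (simp only: mult.assoc)
  qed
  also have "p * (2 * A) * (2 powr (p - 1) / (p - 1)) = p * 5 ^ DIM('a) * 2 powr p / (p - 1)"
    using p by (simp add: A_def powr_diff field_simps)
  finally show ?thesis .
qed

subsection \<open>Fractional integrals\<close>

text \<open>The Riesz potential without its normalising constant. At y = x the kernel takes the
  value 0, by the convention on \<open>powr\<close>.\<close>

definition riesz :: "real \<Rightarrow> ('a::euclidean_space \<Rightarrow> ennreal) \<Rightarrow> 'a \<Rightarrow> ennreal" where
  "riesz a f x = (\<integral>\<^sup>+y. ennreal (norm (x - y) powr (a - real DIM('a))) * f y \<partial>lborel)"

text \<open>Serves twice: with c = n - a it writes the Riesz kernel as a superposition of balls, and
  with c = n/p - a it sums the large balls.\<close>

lemma nn_integral_powr_greater: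
  assumes c: "0 < c" and d: "0 < d"
  shows "(\<integral>\<^sup>+r. (if d < r then ennreal (r powr (- c - 1)) else 0) \<partial>lborel) = ennreal (d powr (- c) / c)"
proof -
  have "((\<lambda>r. r powr (- c - 1)) has_integral (d powr (- c) / c)) {d..}"
    using has_integral_powr_to_inf[of "- c - 1" d] c d by simp
  then have "(\<integral>\<^sup>+r. ennreal (indicator {d..} r * r powr (- c - 1)) \<partial>lborel) = ennreal (d powr (- c) / c)"
    by (intro nn_integral_has_integral_lebesgue) auto
  moreover have "(\<integral>\<^sup>+r. (if d < r then ennreal (r powr (- c - 1)) else 0) \<partial>lborel)
    = (\<integral>\<^sup>+r. ennreal (indicator {d..} r * r powr (- c - 1)) \<partial>lborel)"
  proof (intro nn_integral_cong_AE)
    show "AE r in lborel. (if d < r then ennreal (r powr (- c - 1)) else 0)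
        = ennreal (indicator {d..} r * r powr (- c - 1))"
      using AE_lborel_singleton[of d] by eventually_elim (auto simp: indicator_def)
  qed
  ultimately show ?thesis by simp
qed

text \<open>The kernel at y is n - a times the integral of r to the power a - n - 1 over r > |x -
  y|; Tonelli then collects the y with |x - y| < r into a ball. It is an inequality because for y =
  x the kernel is 0 while the integral over r diverges.\<close>

lemma riesz_le_ball_integrals:
  fixes f :: "'a::euclidean_space \<Rightarrow> ennreal"
  assumes [measurable]: "f \<in> borel_measurable borel" and a: "a < real DIM('a)"
  shows "riesz a f x \<le> ennreal (real DIM('a) - a) * (\<integral>\<^sup>+r. (if 0 < r then
    ennreal (r powr (a - real DIM('a) - 1)) * (\<integral>\<^sup>+y\<in>ball x r. f y \<partial>lborel) else 0) \<partial>lborel)"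
proof -
  define n where "n = real DIM('a)"
  have kernel: "ennreal (norm (x - y) powr (a - n))
    \<le> ennreal (n - a) * (\<integral>\<^sup>+r. (if norm (x - y) < r then ennreal (r powr (a - n - 1)) else 0) \<partial>lborel)" for y
  proof (cases "x = y")
    case False
    then have "(\<integral>\<^sup>+r. (if norm (x - y) < r then ennreal (r powr (a - n - 1)) else 0) \<partial>lborel)
      = ennreal (norm (x - y) powr (a - n) / (n - a))"
      using nn_integral_powr_greater[of "n - a" "norm (x - y)"] a
      by (simp only: minus_diff_eq) (simp add: n_def)
    then show ?thesis using a by (simp add: n_def flip: ennreal_mult)
  qed simp
  have "riesz a f x \<le> (\<integral>\<^sup>+y. ennreal (n - a) *
    (\<integral>\<^sup>+r. (if norm (x - y) < r then ennreal (r powr (a - n - 1)) else 0) \<partial>lborel) * f y \<partial>lborel)"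
    unfolding riesz_def n_def[symmetric] by (intro nn_integral_mono mult_right_mono kernel) auto
  also have "\<dots> = ennreal (n - a) *
    (\<integral>\<^sup>+y. \<integral>\<^sup>+r. (if norm (x - y) < r then ennreal (r powr (a - n - 1)) else 0) * f y \<partial>lborel \<partial>lborel)"
    by (simp add: nn_integral_cmult nn_integral_multc mult.assoc)
  also have "(\<integral>\<^sup>+y. \<integral>\<^sup>+r. (if norm (x - y) < r then ennreal (r powr (a - n - 1)) else 0) * f y \<partial>lborel \<partial>lborel)
    = (\<integral>\<^sup>+r. \<integral>\<^sup>+y. (if norm (x - y) < r then ennreal (r powr (a - n - 1)) else 0) * f y \<partial>lborel \<partial>lborel)"
    by (intro lborel_pair.Fubini'[symmetric]) measurable
  also have "\<dots> = (\<integral>\<^sup>+r. (if 0 < r then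
    ennreal (r powr (a - n - 1)) * (\<integral>\<^sup>+y\<in>ball x r. f y \<partial>lborel) else 0) \<partial>lborel)"
  proof (intro nn_integral_cong)
    fix r :: real
    have "(\<integral>\<^sup>+y. (if norm (x - y) < r then ennreal (r powr (a - n - 1)) else 0) * f y \<partial>lborel)
      = (\<integral>\<^sup>+y. ennreal (r powr (a - n - 1)) * (f y * indicator (ball x r) y) \<partial>lborel)"
      by (intro nn_integral_cong) (auto simp: indicator_def dist_norm)
    also have "\<dots> = ennreal (r powr (a - n - 1)) * (\<integral>\<^sup>+y\<in>ball x r. f y \<partial>lborel)"
      by (intro nn_integral_cmult borel_measurable_times_ennreal borel_measurable_indicator) auto
    also have "\<dots> = (if 0 < r then
      ennreal (r powr (a - n - 1)) * (\<integral>\<^sup>+y\<in>ball x r. f y \<partial>lborel) else 0)"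
      by (cases "0 < r") (auto simp: ball_empty)
    finally show "(\<integral>\<^sup>+y. (if norm (x - y) < r then ennreal (r powr (a - n - 1)) else 0) * f y \<partial>lborel)
      = (if 0 < r then ennreal (r powr (a - n - 1)) * (\<integral>\<^sup>+y\<in>ball x r. f y \<partial>lborel) else 0)" .
  qed
  finally show ?thesis unfolding n_def .
qed

lemma nn_integral_ball_le_Lp:
  fixes f :: "'a::euclidean_space \<Rightarrow> ennreal"
  assumes [measurable]: "f \<in> borel_measurable borel" and p: "1 < p"
  shows "(\<integral>\<^sup>+y\<in>ball x r. f y \<partial>lborel)
    \<le> epowr (\<integral>\<^sup>+y. epowr (f y) p \<partial>lborel) (1 / p) * epowr (emeasure lborel (ball x r)) (1 - 1 / p)"
proof -
  have "(\<integral>\<^sup>+y\<in>ball x r. f y \<partial>lborel)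
    = (\<integral>\<^sup>+y. epowr (epowr (f y) p) (1 / p) * epowr (indicator (ball x r) y) (1 - 1 / p) \<partial>lborel)"
    using p by (intro nn_integral_cong) (auto simp: epowr_epowr indicator_def)
  also have "\<dots> \<le> epowr (\<integral>\<^sup>+y. epowr (f y) p \<partial>lborel) (1 / p)
    * epowr (\<integral>\<^sup>+y. indicator (ball x r) y \<partial>lborel) (1 - 1 / p)"
    using p by (intro nn_integral_Holder borel_measurable_indicator) auto
  finally show ?thesis by simp
qed

lemma riesz_le_split:
  fixes f :: "'a::euclidean_space \<Rightarrow> ennreal"
  assumes [measurable]: "f \<in> borel_measurable borel" and a: "0 < a" and p: "1 < p" "p < real DIM('a) / a"
    and R: "0 < R"
  defines "n \<equiv> real DIM('a)"
  defines "v \<equiv> unit_ball_vol n"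
  shows "riesz a f x \<le> ennreal (n - a) *
    (ennreal (v / a * R powr a) * maximal f x
     + ennreal (v powr (1 - 1 / p) / (n / p - a) * R powr (a - n / p))
       * epowr (\<integral>\<^sup>+y. epowr (f y) p \<partial>lborel) (1 / p))"
proof -
  define N where "N = epowr (\<integral>\<^sup>+y. epowr (f y) p \<partial>lborel) (1 / p)"
  have n: "0 < n" by (simp add: n_def)
  have v: "0 < v" using n by (simp add: v_def)
  have ap: "a * p < n" using a p by (simp add: n_def field_simps)
  have "a < n" using ap mult_strict_left_mono[OF p(1) a] by linarith
  have anp: "0 < n / p - a" using ap p by (simp add: field_simps)
  have ball: "emeasure lborel (ball x r) = ennreal (v * r powr n)" if "0 < r" for r
    using emeasure_ball_powr[OF that, of x] by (simp add: v_def n_def)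
  \<comment> \<open>The volume of the ball cancels the power -n of r; what remains is integrable at
    0 since a > 0.\<close>
  have near: "ennreal (r powr (a - n - 1)) * (\<integral>\<^sup>+y\<in>ball x r. f y \<partial>lborel)
    \<le> ennreal (r powr (a - 1)) * (ennreal v * maximal f x)" if r: "0 < r" for r
  proof -
    have "ennreal (r powr (a - n - 1)) * (\<integral>\<^sup>+y\<in>ball x r. f y \<partial>lborel)
      \<le> ennreal (r powr (a - n - 1)) * (emeasure lborel (ball x r) * maximal f x)"
      using r by (intro mult_left_mono nn_integral_ball_le_maximal) auto
    also have "\<dots> = ennreal (r powr (a - n - 1) * r powr n) * (ennreal v * maximal f x)"
      using r v by (simp add: ball ennreal_mult mult_ac)
    also have "r powr (a - n - 1) * r powr n = r powr (a - 1)"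
      by (simp flip: powr_add)
    finally show ?thesis .
  qed
  \<comment> \<open>Hoelder contributes r to the power n(1 - 1/p), which leaves the exponent a - n/p
    - 1, integrable at infinity since p < n/a.\<close>
  have far: "ennreal (r powr (a - n - 1)) * (\<integral>\<^sup>+y\<in>ball x r. f y \<partial>lborel)
    \<le> ennreal (r powr (- (n / p - a) - 1)) * (ennreal (v powr (1 - 1 / p)) * N)" if r: "0 < r" for r
  proof -
    have "ennreal (r powr (a - n - 1)) * (\<integral>\<^sup>+y\<in>ball x r. f y \<partial>lborel)
      \<le> ennreal (r powr (a - n - 1)) * (N * epowr (emeasure lborel (ball x r)) (1 - 1 / p))"
      unfolding N_def using p by (intro mult_left_mono nn_integral_ball_le_Lp) auto
    also have "\<dots> = ennreal (r powr (a - n - 1) * r powr (n * (1 - 1 / p))) * (ennreal (v powr (1 - 1 / p)) * N)"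
    proof -
      have "epowr (emeasure lborel (ball x r)) (1 - 1 / p)
        = ennreal (v powr (1 - 1 / p)) * ennreal (r powr (n * (1 - 1 / p)))"
        unfolding ball[OF r] using r v
        by (subst epowr_ennreal) (auto simp: powr_mult powr_powr ennreal_mult)
      then show ?thesis by (simp add: ennreal_mult mult_ac)
    qed
    also have "r powr (a - n - 1) * r powr (n * (1 - 1 / p)) = r powr (- (n / p - a) - 1)"
      by (simp add: algebra_simps flip: powr_add)
    finally show ?thesis .
  qed
  have "riesz a f x \<le> ennreal (n - a) * (\<integral>\<^sup>+r. (if 0 < r then
    ennreal (r powr (a - n - 1)) * (\<integral>\<^sup>+y\<in>ball x r. f y \<partial>lborel) else 0) \<partial>lborel)"
    using riesz_le_ball_integrals[of f a x, folded n_def] \<open>a < n\<close> by simp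
  also have "\<dots> \<le> ennreal (n - a) * (\<integral>\<^sup>+r.
      (if 0 < r \<and> ennreal r < ennreal R then ennreal (r powr (a - 1)) else 0) * (ennreal v * maximal f x)
    + (if R < r then ennreal (r powr (- (n / p - a) - 1)) else 0) * (ennreal (v powr (1 - 1 / p)) * N) \<partial>lborel)"
  \<comment> \<open>The two pieces cover r < R and r > R; the single radius R is a null set.\<close>
  proof (intro mult_left_mono nn_integral_mono_AE)
    show "AE r in lborel. (if 0 < r then
      ennreal (r powr (a - n - 1)) * (\<integral>\<^sup>+y\<in>ball x r. f y \<partial>lborel) else 0)
      \<le> (if 0 < r \<and> ennreal r < ennreal R then ennreal (r powr (a - 1)) else 0) * (ennreal v * maximal f x)
    + (if R < r then ennreal (r powr (- (n / p - a) - 1)) else 0) * (ennreal (v powr (1 - 1 / p)) * N)"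
      using AE_lborel_singleton[of R]
    proof eventually_elim
      case (elim r)
      then consider "r \<le> 0" | "0 < r" "r < R" | "R < r" by linarith
      then show ?case
        using R near[of r] far[of r] by cases (auto simp: ennreal_less_iff)
    qed
  qed auto
  also have "\<dots> = ennreal (n - a) * (ennreal (R powr a / a) * (ennreal v * maximal f x)
    + ennreal (R powr (- (n / p - a)) / (n / p - a)) * (ennreal (v powr (1 - 1 / p)) * N))"
  proof -
    have "(\<integral>\<^sup>+r. (if 0 < r \<and> ennreal r < ennreal R then ennreal (r powr (a - 1)) else 0) \<partial>lborel)
      = ennreal (R powr a / a)"
      using a R by (subst nn_integral_powr_less) (auto simp: epowr_ennreal simp flip: ennreal_mult)
    then show ?thesis
      using nn_integral_powr_greater[OF anp R] by (simp add: nn_integral_add nn_integral_multc)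
  qed
  also have "\<dots> = ennreal (n - a) *
    (ennreal (v / a * R powr a) * maximal f x
     + ennreal (v powr (1 - 1 / p) / (n / p - a) * R powr (a - n / p)) * N)"
  proof -
    have "ennreal (v / a * R powr a) = ennreal (R powr a / a) * ennreal v"
      using a v by (simp add: mult.commute flip: ennreal_mult)
    moreover have "ennreal (v powr (1 - 1 / p) / (n / p - a) * R powr (a - n / p))
      = ennreal (R powr (- (n / p - a)) / (n / p - a)) * ennreal (v powr (1 - 1 / p))"
      using anp v by (simp add: mult.commute flip: ennreal_mult)
    ultimately show ?thesis by (simp only: mult.assoc)
  qed
  finally show ?thesis by (simp add: N_def)
qed

text \<open>Choosing the best radius in \<open>riesz_le_split\<close> requires the maximal function
  and the p-th power integral to be positive and finite. In the degenerate cases either the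
  potential vanishes or the right side is infinite.\<close>

lemma Hedberg_inequality:
  fixes f :: "'a::euclidean_space \<Rightarrow> ennreal"
  assumes [measurable]: "f \<in> borel_measurable borel" and a: "0 < a" and p: "1 < p" "p < real DIM('a) / a"
    and fin: "(\<integral>\<^sup>+y. epowr (f y) p \<partial>lborel) \<noteq> top"
  defines "n \<equiv> real DIM('a)"
  defines "v \<equiv> unit_ball_vol n"
  shows "riesz a f x \<le> ennreal ((n - a) * (v / a + v powr (1 - 1 / p) / (n / p - a)))
    * epowr (maximal f x) (1 - a * p / n) * epowr (\<integral>\<^sup>+y. epowr (f y) p \<partial>lborel) (a / n)"
    (is "_ \<le> ennreal ?C * _ * _")
proof -
  define I where "I = (\<integral>\<^sup>+y. epowr (f y) p \<partial>lborel)"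
  have n: "0 < n" by (simp add: n_def)
  have v: "0 < v" using n by (simp add: v_def)
  have ap: "a * p < n" using a p by (simp add: n_def field_simps)
  have an: "a < n" using ap mult_strict_left_mono[OF p(1) a] by linarith
  have anp: "0 < n / p - a" using ap p by (simp add: field_simps)
  have C: "0 < ?C" using an v a anp by (intro mult_pos_pos add_pos_pos) auto
  consider "I = 0" | "maximal f x = 0" | "I \<noteq> 0" "maximal f x = top"
    | "I \<noteq> 0" "maximal f x \<noteq> 0" "maximal f x \<noteq> top" by blast
  then show ?thesis
  proof cases
    case 1
    then have "AE y in lborel. f y = 0" by (simp add: I_def nn_integral_0_iff_AE)
    then have "riesz a f x = 0"
      unfolding riesz_def by (subst nn_integral_0_iff_AE) auto
    then show ?thesis by simp
  next
    case 2
    have "(\<integral>\<^sup>+y\<in>ball x r. f y \<partial>lborel) = 0" if "0 < r" for r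
      using nn_integral_ball_le_maximal[of x x r f] that 2 by simp
    then have "(\<integral>\<^sup>+r. (if 0 < r then
      ennreal (r powr (a - n - 1)) * (\<integral>\<^sup>+y\<in>ball x r. f y \<partial>lborel) else 0) \<partial>lborel) = (\<integral>\<^sup>+(r::real). 0 \<partial>lborel)"
      by (intro nn_integral_cong) auto
    then have "riesz a f x = 0"
      using riesz_le_ball_integrals[of f a x, folded n_def] an by simp
    then show ?thesis by simp
  next
    case 3
    then have "ennreal ?C * epowr (maximal f x) (1 - a * p / n) * epowr I (a / n) = top"
      using C by (auto simp: ennreal_mult_eq_top_iff)
    then show ?thesis unfolding I_def by (simp only: top_greatest)
  next
    case 4
    obtain m where m: "maximal f x = ennreal m" "0 < m"
      using 4 by (cases "maximal f x") (auto simp: less_le)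
    obtain i where i: "I = ennreal i" "0 < i"
      using 4 fin by (cases I) (auto simp: less_le I_def)
    \<comment> \<open>The radius that balances the two terms of the splitting.\<close>
    define R where "R = (i powr (1 / p) / m) powr (p / n)"
    have R: "0 < R" using m i by (simp add: R_def)
    have R1: "R powr a * m = m powr (1 - a * p / n) * i powr (a / n)"
    proof -
      have "R powr a = i powr (a / n) / m powr (a * p / n)"
        using m i p by (simp add: R_def powr_powr powr_divide mult.commute)
      then show ?thesis using m by (simp add: powr_diff)
    qed
    have R2: "R powr (a - n / p) * i powr (1 / p) = m powr (1 - a * p / n) * i powr (a / n)"
    proof -
      have "R powr (n / p) = i powr (1 / p) / m"
        using m i p n by (simp add: R_def powr_powr)
      then have "R powr (a - n / p) * i powr (1 / p) = R powr a * m"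
        using m i by (simp add: powr_diff)
      then show ?thesis using R1 by simp
    qed
    have "riesz a f x \<le> ennreal (n - a) *
      (ennreal (v / a * R powr a) * ennreal m
       + ennreal (v powr (1 - 1 / p) / (n / p - a) * R powr (a - n / p)) * epowr I (1 / p))"
      using riesz_le_split[of f a p R x] a p R by (simp add: n_def v_def I_def flip: m(1))
    also have "\<dots> = ennreal ((n - a) * (v / a * (R powr a * m)
      + v powr (1 - 1 / p) / (n / p - a) * (R powr (a - n / p) * i powr (1 / p))))"
    proof -
      have "ennreal (v / a * R powr a) * ennreal m = ennreal (v / a * (R powr a * m))"
        using a v m by (simp add: mult.assoc flip: ennreal_mult)
      moreover have "ennreal (v powr (1 - 1 / p) / (n / p - a) * R powr (a - n / p)) * epowr I (1 / p)
        = ennreal (v powr (1 - 1 / p) / (n / p - a) * (R powr (a - n / p) * i powr (1 / p)))"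
        using anp i by (simp add: epowr_ennreal mult.assoc flip: ennreal_mult)
      moreover have "0 \<le> v / a * (R powr a * m)"
        "0 \<le> v powr (1 - 1 / p) / (n / p - a) * (R powr (a - n / p) * i powr (1 / p))"
        using a v m anp by auto
      ultimately show ?thesis
        using an by (simp only: ennreal_plus ennreal_mult add_nonneg_nonneg)
    qed
    also have "\<dots> = ennreal (?C * m powr (1 - a * p / n) * i powr (a / n))"
      unfolding R1 R2 by (simp add: algebra_simps)
    also have "\<dots> = ennreal ?C * epowr (maximal f x) (1 - a * p / n) * epowr I (a / n)"
      using C m i by (simp add: epowr_ennreal ennreal_mult)
    finally show ?thesis unfolding I_def .
  qed
qed

text \<open>Raise Hedberg's inequality to the power q. The relation between p and q says precisely
  that the maximal function then carries the exponent p (\<open>e1\<close>), so the maximal theorem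
  applies, and that the powers of the p-th power integral add up to q/p (\<open>e2\<close>).\<close>

lemma Hardy_Littlewood_Sobolev:
  assumes a: "0 < a" and p: "1 < p" "p < real DIM('a) / a"
    and q: "1 / q = 1 / p - a / real DIM('a)"
  obtains C where "0 < C" "\<And>f :: 'a::euclidean_space \<Rightarrow> ennreal. f \<in> borel_measurable borel \<Longrightarrow>
    (\<integral>\<^sup>+x. epowr (riesz a f x) q \<partial>lborel) \<le> ennreal C * epowr (\<integral>\<^sup>+x. epowr (f x) p \<partial>lborel) (q / p)"
proof -
  define n where "n = real DIM('a)"
  define v where "v = unit_ball_vol n"
  define C0 where "C0 = (n - a) * (v / a + v powr (1 - 1 / p) / (n / p - a))"
  define A where "A = p * 5 ^ DIM('a) * 2 powr p / (p - 1)"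
  have n: "0 < n" by (simp add: n_def)
  have v: "0 < v" using n by (simp add: v_def)
  have ap: "a * p < n" using a p by (simp add: n_def field_simps)
  have an: "a < n" using ap mult_strict_left_mono[OF p(1) a] by linarith
  have anp: "0 < n / p - a" using ap p by (simp add: field_simps)
  have C0: "0 < C0" unfolding C0_def using an v a anp by (intro mult_pos_pos add_pos_pos) auto
  have A: "0 < A" unfolding A_def using p by (intro divide_pos_pos mult_pos_pos) auto
  have "1 / q = (n - a * p) / (p * n)"
    using q p n by (simp add: n_def field_simps)
  then have qv: "q = p * n / (n - a * p)"
    by (metis inverse_divide inverse_eq_divide inverse_inverse_eq)
  have q0: "0 < q" using qv p n ap by simp
  have e1: "(1 - a * p / n) * q = p"
    unfolding qv using n ap by (simp add: field_simps)
  have e2: "a / n * q + 1 = q / p"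
    unfolding qv using n ap p by (simp add: field_simps)
  show thesis
  proof
    show "0 < C0 powr q * A" using C0 A by simp
    fix f :: "'a \<Rightarrow> ennreal"
    assume [measurable]: "f \<in> borel_measurable borel"
    define I where "I = (\<integral>\<^sup>+y. epowr (f y) p \<partial>lborel)"
    show "(\<integral>\<^sup>+x. epowr (riesz a f x) q \<partial>lborel) \<le> ennreal (C0 powr q * A) * epowr I (q / p)"
    proof (cases "I = top")
      case True
      then have "ennreal (C0 powr q * A) * epowr I (q / p) = top"
        using C0 A by (simp add: ennreal_mult_eq_top_iff)
      then show ?thesis by (simp only: top_greatest)
    next
      case False
      have "(\<integral>\<^sup>+x. epowr (riesz a f x) q \<partial>lborel)
        \<le> (\<integral>\<^sup>+x. ennreal (C0 powr q) * epowr I (a / n * q) * epowr (maximal f x) p \<partial>lborel)"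
      proof (intro nn_integral_mono)
        fix x
        have "epowr (riesz a f x) q
          \<le> epowr (ennreal C0 * epowr (maximal f x) (1 - a * p / n) * epowr I (a / n)) q"
          using Hedberg_inequality[of f a p x] a p q0 False
          by (intro epowr_mono) (auto simp: I_def C0_def v_def n_def)
        also have "\<dots> = ennreal (C0 powr q) * epowr (maximal f x) ((1 - a * p / n) * q) * epowr I (a / n * q)"
          using q0 C0 by (simp add: epowr_mult epowr_epowr epowr_ennreal)
        finally show "epowr (riesz a f x) q \<le> ennreal (C0 powr q) * epowr I (a / n * q) * epowr (maximal f x) p"
          unfolding e1 by (simp add: mult_ac)
      qed
      also have "\<dots> = ennreal (C0 powr q) * epowr I (a / n * q) * (\<integral>\<^sup>+x. epowr (maximal f x) p \<partial>lborel)"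
        by (intro nn_integral_cmult) auto
      also have "\<dots> \<le> ennreal (C0 powr q) * epowr I (a / n * q) * (ennreal A * I)"
        unfolding I_def A_def using p by (intro mult_left_mono maximal_strong_type) auto
      also have "\<dots> = ennreal (C0 powr q * A) * (epowr I (a / n * q) * epowr I 1)"
        using A by (simp add: ennreal_mult mult_ac)
      also have "\<dots> = ennreal (C0 powr q * A) * epowr I (q / p)"
        unfolding epowr_add[symmetric] e2 ..
      finally show ?thesis .
    qed
  qed
qed

subsection \<open>The product fractional integral\<close>

definition biriesz :: "real \<Rightarrow> real \<Rightarrow> ('a::euclidean_space \<times> 'b::euclidean_space \<Rightarrow> ennreal) \<Rightarrow> 'a \<times> 'b \<Rightarrow> ennreal" where
  "biriesz a1 a2 f x = (\<integral>\<^sup>+y. ennreal (norm (fst x - fst y) powr (a1 - real DIM('a))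
     * norm (snd x - snd y) powr (a2 - real DIM('b))) * f y \<partial>lborel)"

lemma biriesz_eq_iterated:
  fixes f :: "'a::euclidean_space \<times> 'b::euclidean_space \<Rightarrow> ennreal"
  assumes "f \<in> borel_measurable borel"
  shows "biriesz a1 a2 f (x1, x2) = riesz a1 (\<lambda>y1. riesz a2 (\<lambda>y2. f (y1, y2)) x2) x1"
proof -
  have [measurable]: "f \<in> borel_measurable (lborel \<Otimes>\<^sub>M lborel)"
    using assms by (simp add: lborel_prod)
  have "biriesz a1 a2 f (x1, x2) = (\<integral>\<^sup>+y. ennreal (norm (x1 - fst y) powr (a1 - real DIM('a))
     * norm (x2 - snd y) powr (a2 - real DIM('b))) * f y \<partial>(lborel \<Otimes>\<^sub>M lborel))"
    by (simp add: biriesz_def lborel_prod)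
  also have "\<dots> = (\<integral>\<^sup>+y1. \<integral>\<^sup>+y2. ennreal (norm (x1 - y1) powr (a1 - real DIM('a))
     * norm (x2 - y2) powr (a2 - real DIM('b))) * f (y1, y2) \<partial>lborel \<partial>lborel)"
    by (subst lborel.nn_integral_fst[symmetric]) auto
  also have "\<dots> = riesz a1 (\<lambda>y1. riesz a2 (\<lambda>y2. f (y1, y2)) x2) x1"
    unfolding riesz_def
    by (subst nn_integral_cmult[symmetric]) (auto simp: ennreal_mult mult.assoc)
  finally show ?thesis .
qed

lemma borel_measurable_biriesz:
  fixes f :: "'a::euclidean_space \<times> 'b::euclidean_space \<Rightarrow> ennreal"
  assumes f: "f \<in> borel_measurable borel"
  shows "biriesz a1 a2 f \<in> borel_measurable borel"
proof -
  have [measurable]: "f \<in> borel_measurable (lborel \<Otimes>\<^sub>M lborel)"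
    using f by (simp add: lborel_prod)
  have "(\<lambda>(x1, x2). riesz a1 (\<lambda>y1. riesz a2 (\<lambda>y2. f (y1, y2)) x2) x1) \<in> borel_measurable (lborel \<Otimes>\<^sub>M lborel)"
    unfolding riesz_def by measurable
  also have "(\<lambda>(x1, x2). riesz a1 (\<lambda>y1. riesz a2 (\<lambda>y2. f (y1, y2)) x2) x1) = biriesz a1 a2 f"
    by (auto simp: fun_eq_iff biriesz_eq_iterated[OF f])
  finally show ?thesis by (simp add: lborel_prod)
qed

text \<open>For fixed \<open>x2\<close> the one-parameter estimate in \<open>x1\<close> leaves an
  L^p norm in \<open>y1\<close> of a fractional integral over \<open>y2\<close>. Minkowski moves the
  norm inside, which gives the fractional integral of the function \<Phi> of slice norms; the second
  estimate applies to it, and the L^p norm of \<Phi> is that of \<open>f\<close> by Tonelli.\<close>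

lemma biriesz_Lp_Lq:
  assumes a: "0 < a1" "0 < a2" and dim: "a1 / real DIM('a) = a2 / real DIM('b)"
    and p: "1 < p" "p < real DIM('a) / a1"
    and q: "1 / q = 1 / p - a1 / real DIM('a)"
  obtains C where "0 < C"
    "\<And>f :: 'a::euclidean_space \<times> 'b::euclidean_space \<Rightarrow> ennreal. f \<in> borel_measurable borel \<Longrightarrow>
    (\<integral>\<^sup>+x. epowr (biriesz a1 a2 f x) q \<partial>lborel) \<le> ennreal C * epowr (\<integral>\<^sup>+x. epowr (f x) p \<partial>lborel) (q / p)"
proof -
  \<comment> \<open>Equal ratios make p admissible in the second variable too, and
    \<open>q[unfolded dim]\<close> gives the same q there.\<close>
  have p': "p < real DIM('b) / a2"
  proof -
    have "real DIM('b) / a2 = inverse (a1 / real DIM('a))" using dim by simp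
    then show ?thesis using p by simp
  qed
  have "1 / p > a1 / real DIM('a)"
    using p a by (simp add: field_simps)
  then have q0: "0 < q" using q by (metis diff_gt_0_iff_gt zero_less_divide_1_iff)
  obtain C1 where C1: "0 < C1" "\<And>f :: 'a \<Rightarrow> ennreal. f \<in> borel_measurable borel \<Longrightarrow>
    (\<integral>\<^sup>+x. epowr (riesz a1 f x) q \<partial>lborel) \<le> ennreal C1 * epowr (\<integral>\<^sup>+x. epowr (f x) p \<partial>lborel) (q / p)"
    using Hardy_Littlewood_Sobolev[OF a(1) p q] by blast
  obtain C2 where C2: "0 < C2" "\<And>f :: 'b \<Rightarrow> ennreal. f \<in> borel_measurable borel \<Longrightarrow>
    (\<integral>\<^sup>+x. epowr (riesz a2 f x) q \<partial>lborel) \<le> ennreal C2 * epowr (\<integral>\<^sup>+x. epowr (f x) p \<partial>lborel) (q / p)"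
    using Hardy_Littlewood_Sobolev[OF a(2) p(1) p' q[unfolded dim]] by blast
  show thesis
  proof
    show "0 < C1 * C2" using C1 C2 by simp
    fix f :: "'a \<times> 'b \<Rightarrow> ennreal"
    assume f: "f \<in> borel_measurable borel"
    then have [measurable]: "f \<in> borel_measurable (lborel \<Otimes>\<^sub>M lborel)"
      by (simp add: lborel_prod)
    define G where "G x2 y1 = riesz a2 (\<lambda>y2. f (y1, y2)) x2" for x2 y1
    define \<Phi> where "\<Phi> y2 = epowr (\<integral>\<^sup>+y1. epowr (f (y1, y2)) p \<partial>lborel) (1 / p)" for y2
    have [measurable]: "(\<lambda>(x2, y1). G x2 y1) \<in> borel_measurable (lborel \<Otimes>\<^sub>M lborel)"
      unfolding G_def riesz_def by measurable
    have [measurable]: "(\<lambda>(x1, x2). riesz a1 (G x2) x1) \<in> borel_measurable (lborel \<Otimes>\<^sub>M lborel)"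
      unfolding riesz_def by measurable
    have [measurable]: "\<Phi> \<in> borel_measurable borel"
      unfolding \<Phi>_def by measurable
    have mink: "epowr (\<integral>\<^sup>+y1. epowr (G x2 y1) p \<partial>lborel) (1 / p) \<le> riesz a2 \<Phi> x2" for x2
    proof -
      have "epowr (\<integral>\<^sup>+y1. epowr (G x2 y1) p \<partial>lborel) (1 / p)
        \<le> (\<integral>\<^sup>+y2. epowr (\<integral>\<^sup>+y1. epowr (ennreal (norm (x2 - y2) powr (a2 - real DIM('b))) * f (y1, y2)) p \<partial>lborel) (1 / p) \<partial>lborel)"
        unfolding G_def riesz_def using p by (intro nn_integral_Minkowski) measurable
      also have "\<dots> = riesz a2 \<Phi> x2"
        unfolding riesz_def \<Phi>_def
      proof (intro nn_integral_cong)
        fix y2 :: 'b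
        define k where "k = norm (x2 - y2) powr (a2 - real DIM('b))"
        have k: "0 \<le> k" by (simp add: k_def)
        \<comment> \<open>The kernel in the second variable does not depend on \<open>y1\<close>, so
          it leaves the norm as a factor.\<close>
        have "(\<integral>\<^sup>+y1. epowr (ennreal k * f (y1, y2)) p \<partial>lborel) = epowr (ennreal k) p * (\<integral>\<^sup>+y1. epowr (f (y1, y2)) p \<partial>lborel)"
          using p by (simp add: epowr_mult nn_integral_cmult)
        then show "epowr (\<integral>\<^sup>+y1. epowr (ennreal k * f (y1, y2)) p \<partial>lborel) (1 / p)
          = ennreal k * epowr (\<integral>\<^sup>+y1. epowr (f (y1, y2)) p \<partial>lborel) (1 / p)"
          using p by (simp add: epowr_mult epowr_epowr)
      qed
      finally show ?thesis .
    qed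
    have "(\<integral>\<^sup>+x. epowr (biriesz a1 a2 f x) q \<partial>lborel)
      = (\<integral>\<^sup>+x. (\<lambda>(x1, x2). epowr (riesz a1 (G x2) x1) q) x \<partial>(lborel \<Otimes>\<^sub>M lborel))"
      unfolding lborel_prod
      by (intro nn_integral_cong) (auto simp: biriesz_eq_iterated[OF f] G_def[abs_def])
    also have "\<dots> = (\<integral>\<^sup>+x2. \<integral>\<^sup>+x1. epowr (riesz a1 (G x2) x1) q \<partial>lborel \<partial>lborel)"
      by (subst lborel_pair.nn_integral_snd[symmetric]) auto
    also have "\<dots> \<le> (\<integral>\<^sup>+x2. ennreal C1 * epowr (riesz a2 \<Phi> x2) q \<partial>lborel)"
    proof (intro nn_integral_mono)
      fix x2 :: 'b
      have "(\<integral>\<^sup>+x1. epowr (riesz a1 (G x2) x1) q \<partial>lborel)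
        \<le> ennreal C1 * epowr (epowr (\<integral>\<^sup>+y1. epowr (G x2 y1) p \<partial>lborel) (1 / p)) q"
        using C1(2)[of "G x2"] by (simp add: epowr_epowr)
      also have "\<dots> \<le> ennreal C1 * epowr (riesz a2 \<Phi> x2) q"
        using q0 mink by (intro mult_left_mono epowr_mono) auto
      finally show "(\<integral>\<^sup>+x1. epowr (riesz a1 (G x2) x1) q \<partial>lborel) \<le> ennreal C1 * epowr (riesz a2 \<Phi> x2) q" .
    qed
    also have "\<dots> = ennreal C1 * (\<integral>\<^sup>+x2. epowr (riesz a2 \<Phi> x2) q \<partial>lborel)"
      unfolding riesz_def by (intro nn_integral_cmult) measurable
    also have "\<dots> \<le> ennreal C1 * (ennreal C2 * epowr (\<integral>\<^sup>+y2. epowr (\<Phi> y2) p \<partial>lborel) (q / p))"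
      by (intro mult_left_mono C2(2)) auto
    also have "(\<integral>\<^sup>+y2. epowr (\<Phi> y2) p \<partial>lborel) = (\<integral>\<^sup>+y2. \<integral>\<^sup>+y1. epowr (f (y1, y2)) p \<partial>lborel \<partial>lborel)"
      using p by (simp add: \<Phi>_def epowr_epowr)
    also have "\<dots> = (\<integral>\<^sup>+y. epowr (f y) p \<partial>(lborel \<Otimes>\<^sub>M lborel))"
      by (subst lborel_pair.nn_integral_snd[symmetric]) auto
    finally show "(\<integral>\<^sup>+x. epowr (biriesz a1 a2 f x) q \<partial>lborel)
      \<le> ennreal (C1 * C2) * epowr (\<integral>\<^sup>+x. epowr (f x) p \<partial>lborel) (q / p)"
      using C1 C2 by (simp add: lborel_prod ennreal_mult mult.assoc)
  qed
qed

subsection \<open>Kernels, Lipschitz functions and commutators\<close>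

text \<open>Each instance of the condition is a closed half-line of constants C, so the infimum is
  itself admissible. Testing at unit vectors against the origin shows that the admissible constants
  are bounded below by 0.\<close>

lemma lip_cond_lip_norm:
  fixes b :: "(real^'n) \<times> (real^'m) \<Rightarrow> real"
  assumes "b \<in> Lip a1 a2"
  shows "0 \<le> lip_norm b a1 a2" "lip_cond b a1 a2 (lip_norm b a1 a2)"
proof -
  define S where "S = {C. lip_cond b a1 a2 C}"
  have ne: "S \<noteq> {}" using assms by (auto simp: S_def Lip_def)
  have nonneg: "0 \<le> C" if "C \<in> S" for C
  proof -
    obtain u :: "real^'n" where u: "norm u = 1" using vector_choose_size[of 1] by auto
    obtain v :: "real^'m" where v: "norm v = 1" using vector_choose_size[of 1] by auto
    have "\<bar>(b (u, v) - b (u, 0)) - (b (0, v) - b (0, 0))\<bar> \<le> C * norm (u - 0) powr a1 * norm (v - 0) powr a2"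
      using that unfolding S_def lip_cond_def by blast
    then show ?thesis using u v by simp
  qed
  show "0 \<le> lip_norm b a1 a2"
    unfolding lip_norm_def S_def[symmetric] using ne nonneg by (intro cInf_greatest)
  show "lip_cond b a1 a2 (lip_norm b a1 a2)"
    unfolding lip_cond_def
  proof (intro allI)
    fix x1 y1 :: "real^'n" and x2 y2 :: "real^'m"
    define d where "d = norm (x1 - y1) powr a1 * norm (x2 - y2) powr a2"
    define D where "D = \<bar>(b (x1, x2) - b (x1, y2)) - (b (y1, x2) - b (y1, y2))\<bar>"
    have le: "D \<le> C * d" if "C \<in> S" for C
      using that unfolding S_def lip_cond_def D_def d_def by (simp add: mult.assoc)
    have "D \<le> lip_norm b a1 a2 * d"
    proof (cases "d = 0")
      case True
      then show ?thesis using ne le by auto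
    next
      case False
      then have d: "0 < d" by (simp add: d_def)
      have "D / d \<le> Inf S"
        using ne le d by (intro cInf_greatest) (auto simp: field_simps)
      then show ?thesis using d by (simp add: lip_norm_def S_def field_simps)
    qed
    then show "\<bar>b (x1, x2) - b (x1, y2) - (b (y1, x2) - b (y1, y2))\<bar>
      \<le> lip_norm b a1 a2 * norm (x1 - y1) powr a1 * norm (x2 - y2) powr a2"
      by (simp add: D_def d_def mult.assoc)
  qed
qed

text \<open>With the denominator cleared, the size condition makes a fixed number a lower bound for
  all admissible constants, and hence for their infimum.\<close>

lemma kernel_size_bound:
  fixes K :: "real^'n \<Rightarrow> real^'n \<Rightarrow> real^'m \<Rightarrow> real^'m \<Rightarrow> real"
  assumes "is_kernel K e1 e2"
  shows "0 \<le> kernel_norm K e1 e2"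
    "\<And>x1 y1 x2 y2. x1 \<noteq> y1 \<Longrightarrow> x2 \<noteq> y2 \<Longrightarrow> \<bar>K x1 y1 x2 y2\<bar>
      \<le> kernel_norm K e1 e2 / (norm (x1 - y1) powr real CARD('n) * norm (x2 - y2) powr real CARD('m))"
proof -
  define S where "S = {C. kernel_cond K e1 e2 C}"
  have ne: "S \<noteq> {}" using assms by (auto simp: S_def is_kernel_def)
  have size: "\<bar>K x1 y1 x2 y2\<bar> * (norm (x1 - y1) powr real CARD('n) * norm (x2 - y2) powr real CARD('m)) \<le> C"
    if "C \<in> S" "x1 \<noteq> y1" "x2 \<noteq> y2" for C x1 y1 x2 y2
  proof -
    have "\<bar>K x1 y1 x2 y2\<bar> \<le> C / (norm (x1 - y1) powr real CARD('n) * norm (x2 - y2) powr real CARD('m))"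
      using that unfolding S_def kernel_cond_def Let_def by blast
    then show ?thesis using that by (simp add: pos_le_divide_eq)
  qed
  have nonneg: "0 \<le> C" if "C \<in> S" for C
  proof -
    obtain u :: "real^'n" where u: "norm u = 1" using vector_choose_size[of 1] by auto
    obtain v :: "real^'m" where v: "norm v = 1" using vector_choose_size[of 1] by auto
    have "\<bar>K u 0 v 0\<bar> * (norm (u - 0) powr real CARD('n) * norm (v - 0) powr real CARD('m)) \<le> C"
      using u v by (intro size[OF that]) auto
    then show ?thesis using u v by simp
  qed
  show "0 \<le> kernel_norm K e1 e2"
    unfolding kernel_norm_def S_def[symmetric] using ne nonneg by (intro cInf_greatest)
  show "\<bar>K x1 y1 x2 y2\<bar>
    \<le> kernel_norm K e1 e2 / (norm (x1 - y1) powr real CARD('n) * norm (x2 - y2) powr real CARD('m))"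
    if "x1 \<noteq> y1" "x2 \<noteq> y2" for x1 y1 x2 y2
  proof -
    have "\<bar>K x1 y1 x2 y2\<bar> * (norm (x1 - y1) powr real CARD('n) * norm (x2 - y2) powr real CARD('m)) \<le> Inf S"
      using ne size that by (intro cInf_greatest) auto
    then show ?thesis using that by (simp add: pos_le_divide_eq kernel_norm_def S_def)
  qed
qed

text \<open>The rectangular difference only sees \<open>b\<close> up to functions of one variable, so it is
  regular although \<open>b\<close> itself need not even be measurable.\<close>

definition rect_diff :: "('a \<times> 'b \<Rightarrow> real) \<Rightarrow> 'a \<times> 'b \<Rightarrow> 'a \<times> 'b \<Rightarrow> real" where
  "rect_diff b x y = b (fst x, snd x) - b (fst x, snd y) - b (fst y, snd x) + b (fst y, snd y)"

section \<open>Size and measurability of the rectangular difference and of the integrand\<close>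

lemma abs_rect_diff_le:
  assumes "b \<in> Lip a1 a2"
  shows "\<bar>rect_diff b x y\<bar> \<le> lip_norm b a1 a2 * norm (fst x - fst y) powr a1 * norm (snd x - snd y) powr a2"
proof -
  have "\<bar>(b (fst x, snd x) - b (fst x, snd y)) - (b (fst y, snd x) - b (fst y, snd y))\<bar>
    \<le> lip_norm b a1 a2 * norm (fst x - fst y) powr a1 * norm (snd x - snd y) powr a2"
    using lip_cond_lip_norm(2)[OF assms] unfolding lip_cond_def by blast
  then show ?thesis by (simp add: rect_diff_def algebra_simps)
qed

text \<open>This function differs from \<open>b\<close> only by functions of one variable, and its
  increments are sums of rectangular differences, which the Lipschitz condition controls.\<close>

lemma continuous_rect_diff_origin:
  fixes b :: "(real^'n) \<times> (real^'m) \<Rightarrow> real"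
  assumes b: "b \<in> Lip a1 a2" and a: "0 < a1" "0 < a2"
  shows "continuous_on UNIV (\<lambda>x. rect_diff b x (0, 0))"
proof (clarsimp simp: continuous_on_eq_continuous_at isCont_def)
  fix u :: "real^'n" and v :: "real^'m"
  define L where "L = lip_norm b a1 a2"
  have bd: "\<bar>rect_diff b x (0, 0) - rect_diff b (u, v) (0, 0)\<bar>
    \<le> L * norm (fst x - u) powr a1 * norm (snd x) powr a2 + L * norm u powr a1 * norm (snd x - v) powr a2" for x
  proof -
    \<comment> \<open>Move one coordinate at a time: the first rectangle has sides
      \<open>fst x - u\<close> and \<open>snd x\<close>, the second \<open>u\<close> and
      \<open>snd x - v\<close>.\<close>
    have "rect_diff b x (0, 0) - rect_diff b (u, v) (0, 0)
      = rect_diff b x (u, 0) + rect_diff b (u, snd x) (0, v)"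
      by (simp add: rect_diff_def)
    then show ?thesis
      using abs_rect_diff_le[OF b, of x "(u, 0)"] abs_rect_diff_le[OF b, of "(u, snd x)" "(0, v)"]
      by (simp add: L_def)
  qed
  have "((\<lambda>x. L * norm (fst x - u) powr a1 * norm (snd x) powr a2 + L * norm u powr a1 * norm (snd x - v) powr a2)
    \<longlongrightarrow> L * norm (fst (u, v) - u) powr a1 * norm (snd (u, v)) powr a2 + L * norm u powr a1 * norm (snd (u, v) - v) powr a2) (at (u, v))"
    \<comment> \<open>Positivity of the exponents makes \<open>powr\<close> continuous at base 0,
      where both terms vanish.\<close>
    using a by (intro tendsto_intros tendsto_powr2) (auto intro!: always_eventually)
  then have "((\<lambda>x. rect_diff b x (0, 0) - rect_diff b (u, v) (0, 0)) \<longlongrightarrow> 0) (at (u, v))"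
    by (intro Lim_null_comparison[OF always_eventually[OF allI[OF bd[folded real_norm_def]]]]) simp
  then show "((\<lambda>x. rect_diff b x (0, 0)) \<longlongrightarrow> rect_diff b (u, v) (0, 0)) (at (u, v))"
    by (simp add: LIM_zero_iff)
qed

text \<open>Rectangular differences annihilate functions of one variable, so \<open>b\<close> may be
  replaced at the four corners by its continuous normalisation, which turns the expression into a
  continuous function of the pair.\<close>

lemma borel_measurable_rect_diff:
  fixes b :: "(real^'n) \<times> (real^'m) \<Rightarrow> real"
  assumes "b \<in> Lip a1 a2" "0 < a1" "0 < a2"
  shows "(\<lambda>(x, y). rect_diff b x y) \<in> borel_measurable borel"
proof -
  have eq: "(\<lambda>(x, y). rect_diff b x y) = (\<lambda>z. rect_diff b (fst (fst z), snd (fst z)) (0, 0)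
    - rect_diff b (fst (fst z), snd (snd z)) (0, 0) - rect_diff b (fst (snd z), snd (fst z)) (0, 0)
    + rect_diff b (fst (snd z), snd (snd z)) (0, 0))"
    by (auto simp: rect_diff_def fun_eq_iff)
  show ?thesis
    unfolding eq
    by (intro borel_measurable_continuous_onI continuous_intros
        continuous_on_compose2[OF continuous_rect_diff_origin[OF assms]]) auto
qed

text \<open>\<open>K\<close> is continuous only on the open set off both diagonals and arbitrary
  elsewhere. The rectangular difference is 0 there, so cutting \<open>K\<close> off with an
  indicator leaves the product unchanged.\<close>

lemma borel_measurable_kernel_rect_diff:
  fixes b :: "(real^'n) \<times> (real^'m) \<Rightarrow> real"
  assumes b: "b \<in> Lip a1 a2" "0 < a1" "0 < a2" and K: "is_kernel K e1 e2"
  shows "(\<lambda>(x, y). K (fst x) (fst y) (snd x) (snd y) * rect_diff b x y) \<in> borel_measurable borel"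
proof -
  define S :: "((real^'n) \<times> (real^'n) \<times> (real^'m) \<times> (real^'m)) set"
    where "S = {(x1, y1, x2, y2). x1 \<noteq> y1 \<and> x2 \<noteq> y2}"
  have S: "S = {z. fst z \<noteq> fst (snd z)} \<inter> {z. fst (snd (snd z)) \<noteq> snd (snd (snd z))}"
    by (auto simp: S_def)
  have "open S"
    unfolding S by (intro open_Int open_Collect_neq continuous_intros)
  then have meas: "(\<lambda>z. indicator S z *\<^sub>R (case z of (x1, y1, x2, y2) \<Rightarrow> K x1 y1 x2 y2)) \<in> borel_measurable borel"
    using K unfolding is_kernel_def S_def[symmetric]
    by (intro borel_measurable_continuous_on_indicator) auto
  have "(\<lambda>z :: ((real^'n) \<times> (real^'m)) \<times> ((real^'n) \<times> (real^'m)).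
    (fst (fst z), fst (snd z), snd (fst z), snd (snd z))) \<in> borel_measurable borel"
    by (intro borel_measurable_continuous_onI continuous_intros)
  from measurable_compose[OF this meas]
  have "(\<lambda>z. (indicator S (fst (fst z), fst (snd z), snd (fst z), snd (snd z))
    *\<^sub>R K (fst (fst z)) (fst (snd z)) (snd (fst z)) (snd (snd z))) * (case z of (x, y) \<Rightarrow> rect_diff b x y))
    \<in> borel_measurable borel"
    by (intro borel_measurable_times borel_measurable_rect_diff[OF b]) simp
  also have "(\<lambda>z. (indicator S (fst (fst z), fst (snd z), snd (fst z), snd (snd z))
    *\<^sub>R K (fst (fst z)) (fst (snd z)) (snd (fst z)) (snd (snd z))) * (case z of (x, y) \<Rightarrow> rect_diff b x y))
    = (\<lambda>(x, y). K (fst x) (fst y) (snd x) (snd y) * rect_diff b x y)"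
    by (auto simp: fun_eq_iff indicator_def S_def rect_diff_def)
  finally show ?thesis .
qed

lemma kernel_rect_diff_bound:
  fixes b :: "(real^'n) \<times> (real^'m) \<Rightarrow> real"
  assumes b: "b \<in> Lip a1 a2" and K: "is_kernel K e1 e2"
  shows "\<bar>K (fst x) (fst y) (snd x) (snd y) * rect_diff b x y\<bar>
    \<le> kernel_norm K e1 e2 * lip_norm b a1 a2 *
      (norm (fst x - fst y) powr (a1 - real CARD('n)) * norm (snd x - snd y) powr (a2 - real CARD('m)))"
proof (cases "fst x = fst y \<or> snd x = snd y")
  case True
  then have "rect_diff b x y = 0" by (elim disjE) (simp_all add: rect_diff_def)
  then show ?thesis
    using kernel_size_bound(1)[OF K] lip_cond_lip_norm(1)[OF b] by simp
next
  case False
  have "\<bar>K (fst x) (fst y) (snd x) (snd y) * rect_diff b x y\<bar>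
    \<le> kernel_norm K e1 e2 / (norm (fst x - fst y) powr real CARD('n) * norm (snd x - snd y) powr real CARD('m))
      * (lip_norm b a1 a2 * norm (fst x - fst y) powr a1 * norm (snd x - snd y) powr a2)"
    unfolding abs_mult using False kernel_size_bound[OF K]
    by (intro mult_mono abs_rect_diff_le[OF b]) auto
  also have "\<dots> = kernel_norm K e1 e2 * lip_norm b a1 a2 *
      (norm (fst x - fst y) powr (a1 - real CARD('n)) * norm (snd x - snd y) powr (a2 - real CARD('m)))"
    by (simp add: powr_diff)
  finally show ?thesis .
qed

text \<open>Passing to a Borel representative and to \<open>lborel\<close> opens the way to product
  measures. The equality holds at every x, not merely almost everywhere, because only the
  integration variable is affected.\<close>

lemma commutator_cong_AE:
  fixes b :: "(real^'n) \<times> (real^'m) \<Rightarrow> real"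
  assumes b: "b \<in> Lip a1 a2" "0 < a1" "0 < a2" and K: "is_kernel K e1 e2"
    and f: "f \<in> borel_measurable lebesgue" and g: "g \<in> borel_measurable borel"
    and ae: "AE x in lebesgue. f x = g x"
  shows "commutator b K f x
    = (LINT y|lborel. K (fst x) (fst y) (snd x) (snd y) * rect_diff b x y * g y)"
proof -
  define R where "R y = K (fst x) (fst y) (snd x) (snd y) * rect_diff b x y" for y
  have m: "R \<in> borel_measurable borel"
    using measurable_compose[OF _ borel_measurable_kernel_rect_diff[OF b K], of "\<lambda>y. (x, y)" borel]
    by (simp add: R_def[abs_def] borel_measurable_continuous_onI continuous_intros)
  have "commutator b K f x = (LINT y|lebesgue. R y * f y)"
    by (simp add: commutator_def rect_diff_def R_def)
  also have "\<dots> = (LINT y|lebesgue. R y * g y)"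
    using ae m f g
    by (intro integral_cong_AE borel_measurable_times) (auto intro: measurable_completion)
  also have "\<dots> = (LINT y|lborel. R y * g y)"
    using m g by (intro integral_completion borel_measurable_times) auto
  finally show ?thesis by (simp add: R_def)
qed

text \<open>Needs no absolute convergence: if the integrand is not integrable, its Bochner integral
  is 0 and the bound is trivial.\<close>

lemma ennreal_abs_commutator_le:
  fixes b :: "(real^'n) \<times> (real^'m) \<Rightarrow> real"
  assumes b: "b \<in> Lip a1 a2" and K: "is_kernel K e1 e2" and g: "g \<in> borel_measurable borel"
  shows "ennreal \<bar>LINT y|lborel. K (fst x) (fst y) (snd x) (snd y) * rect_diff b x y * g y\<bar>
    \<le> ennreal (kernel_norm K e1 e2 * lip_norm b a1 a2) * biriesz a1 a2 (\<lambda>y. ennreal \<bar>g y\<bar>) x"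
proof -
  define R where "R y = K (fst x) (fst y) (snd x) (snd y) * rect_diff b x y" for y
  define k where "k y = norm (fst x - fst y) powr (a1 - real CARD('n)) * norm (snd x - snd y) powr (a2 - real CARD('m))" for y
  define A where "A = kernel_norm K e1 e2 * lip_norm b a1 a2"
  have A: "0 \<le> A" using kernel_size_bound(1)[OF K] lip_cond_lip_norm(1)[OF b] by (simp add: A_def)
  have k: "0 \<le> k y" for y by (simp add: k_def)
  have [measurable]: "k \<in> borel_measurable borel"
    unfolding k_def
    by (intro borel_measurable_times powr_real_measurable borel_measurable_const
        borel_measurable_continuous_onI continuous_intros)
  have "ennreal \<bar>LINT y|lborel. R y * g y\<bar> \<le> (\<integral>\<^sup>+y. ennreal \<bar>R y * g y\<bar> \<partial>lborel)"
  proof (cases "integrable lborel (\<lambda>y. R y * g y)")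
    case True
    then show ?thesis using integral_norm_bound_ennreal[OF True] by simp
  next
    case False
    then show ?thesis by (simp add: not_integrable_integral_eq)
  qed
  also have "\<dots> \<le> (\<integral>\<^sup>+y. ennreal A * (ennreal (k y) * ennreal \<bar>g y\<bar>) \<partial>lborel)"
  proof (intro nn_integral_mono)
    fix y
    have "\<bar>R y * g y\<bar> \<le> A * k y * \<bar>g y\<bar>"
      unfolding abs_mult using kernel_rect_diff_bound[OF b K, of x y]
      by (intro mult_right_mono) (auto simp: R_def A_def k_def abs_mult)
    then have "ennreal \<bar>R y * g y\<bar> \<le> ennreal (A * k y * \<bar>g y\<bar>)" by (rule ennreal_leI)
    then show "ennreal \<bar>R y * g y\<bar> \<le> ennreal A * (ennreal (k y) * ennreal \<bar>g y\<bar>)"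
      using A k by (simp add: ennreal_mult mult.assoc)
  qed
  also have "\<dots> = ennreal A * (\<integral>\<^sup>+y. ennreal (k y) * ennreal \<bar>g y\<bar> \<partial>lborel)"
    using g by (intro nn_integral_cmult) auto
  finally show ?thesis by (simp add: R_def A_def k_def biriesz_def)
qed

theorem theorem1p2:
  fixes e1 e2 a1 a2 p q :: real
  assumes "0 < e1" "e1 \<le> 1" "0 < e2" "e2 \<le> 1"
    and "0 < a1" "a1 \<le> 1" "0 < a2" "a2 \<le> 1"
    and "a1 / real CARD('n) = a2 / real CARD('m)"
    and "1 < p" "p < real CARD('n) / a1"
    and "1 / q = 1 / p - a1 / real CARD('n)"
  shows "\<exists>C>0. \<forall>(b :: (real^'n) \<times> (real^'m) \<Rightarrow> real) K f.
           b \<in> Lip a1 a2 \<longrightarrow> is_kernel K e1 e2 \<longrightarrow> f \<in> Lp_space p \<longrightarrow>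
             commutator b K f \<in> Lp_space q \<and>
             Lp_norm q (commutator b K f)
               \<le> C * kernel_norm K e1 e2 * lip_norm b a1 a2 * Lp_norm p f"
proof -
  have a: "0 < a1" "0 < a2" and p: "1 < p" using assms by auto
  have "1 / p > a1 / real CARD('n)"
    using assms by (simp add: field_simps)
  then have q: "0 < q" using assms by (metis diff_gt_0_iff_gt zero_less_divide_1_iff)
  obtain C where C: "0 < C"
    "\<And>f :: (real^'n) \<times> (real^'m) \<Rightarrow> ennreal. f \<in> borel_measurable borel \<Longrightarrow>
    (\<integral>\<^sup>+x. epowr (biriesz a1 a2 f x) q \<partial>lborel) \<le> ennreal C * epowr (\<integral>\<^sup>+x. epowr (f x) p \<partial>lborel) (q / p)"
    using biriesz_Lp_Lq[where 'a="real^'n" and 'b="real^'m", of a1 a2 p q] assms by auto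
  show ?thesis
  \<comment> \<open>The root comes from passing from q-th powers to norms; \<open>C\<close> was
    fixed before \<open>b\<close>, \<open>K\<close> and \<open>f\<close>.\<close>
  proof (intro exI[of _ "C powr (1 / q)"] conjI allI impI)
    show "0 < C powr (1 / q)" using C by simp
    fix b :: "(real^'n) \<times> (real^'m) \<Rightarrow> real"
      and K :: "real^'n \<Rightarrow> real^'n \<Rightarrow> real^'m \<Rightarrow> real^'m \<Rightarrow> real"
      and f :: "(real^'n) \<times> (real^'m) \<Rightarrow> real"
    assume b: "b \<in> Lip a1 a2" and K: "is_kernel K e1 e2" and "f \<in> Lp_space p"
    then have f: "f \<in> borel_measurable lebesgue" "integrable lebesgue (\<lambda>x. \<bar>f x\<bar> powr p)"
      by (auto simp: Lp_space_def)
    obtain g where g: "g \<in> borel_measurable borel" and "AE x in lborel. f x = g x"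
      using completion_ex_borel_measurable_real[OF f(1)] by auto
    then have ae: "AE x in lebesgue. f x = g x" by (intro AE_completion) auto
    define T where "T x = (LINT y|lborel. K (fst x) (fst y) (snd x) (snd y) * rect_diff b x y * g y)" for x
    have T: "commutator b K f = T"
      unfolding T_def using commutator_cong_AE[OF b a K f(1) g ae] by auto
    \<comment> \<open>Joint measurability in (x, y) makes the parameter integral \<open>T\<close>
      measurable in x.\<close>
    have "(\<lambda>(x, y). K (fst x) (fst y) (snd x) (snd y) * rect_diff b x y * g y) \<in> borel_measurable (lborel \<Otimes>\<^sub>M lborel)"
    proof -
      have "(\<lambda>z. (case z of (x, y) \<Rightarrow> K (fst x) (fst y) (snd x) (snd y) * rect_diff b x y) * g (snd z)) \<in> borel_measurable borel"
        using g by (intro borel_measurable_times borel_measurable_kernel_rect_diff[OF b a K]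
          measurable_compose[OF _ g] borel_measurable_continuous_onI continuous_intros)
      then show ?thesis by (simp add: lborel_prod case_prod_unfold)
    qed
    then have Tm: "T \<in> borel_measurable borel"
      using lborel.borel_measurable_lebesgue_integral[of _ lborel] unfolding T_def by simp
    define A where "A = kernel_norm K e1 e2 * lip_norm b a1 a2"
    have A: "0 \<le> A" using kernel_size_bound(1)[OF K] lip_cond_lip_norm(1)[OF b] by (simp add: A_def)
    define I where "I = (LINT x|lebesgue. \<bar>f x\<bar> powr p)"
    have I: "0 \<le> I" by (simp add: I_def)
    have gI: "(\<integral>\<^sup>+x. epowr (ennreal \<bar>g x\<bar>) p \<partial>lborel) = ennreal I"
    proof -
      have "(\<integral>\<^sup>+x. epowr (ennreal \<bar>g x\<bar>) p \<partial>lborel) = (\<integral>\<^sup>+x. ennreal (\<bar>g x\<bar> powr p) \<partial>lebesgue)"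
        by (simp add: epowr_ennreal nn_integral_completion)
      also have "\<dots> = (\<integral>\<^sup>+x. ennreal (\<bar>f x\<bar> powr p) \<partial>lebesgue)"
        using ae by (intro nn_integral_cong_AE) auto
      also have "\<dots> = ennreal I"
        unfolding I_def using f by (intro nn_integral_eq_integral) auto
      finally show ?thesis .
    qed
    \<comment> \<open>Proved for the extended integral first: its finiteness gives the integrability
      without which the real integral in \<open>Lp_norm\<close> would default to 0.\<close>
    have bound: "(\<integral>\<^sup>+x. ennreal (\<bar>T x\<bar> powr q) \<partial>lebesgue) \<le> ennreal (A powr q * (C * I powr (q / p)))"
    proof -
      have "(\<integral>\<^sup>+x. ennreal (\<bar>T x\<bar> powr q) \<partial>lebesgue) = (\<integral>\<^sup>+x. epowr (ennreal \<bar>T x\<bar>) q \<partial>lborel)"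
        by (simp add: epowr_ennreal nn_integral_completion)
      also have "\<dots> \<le> (\<integral>\<^sup>+x. epowr (ennreal A * biriesz a1 a2 (\<lambda>y. ennreal \<bar>g y\<bar>) x) q \<partial>lborel)"
        unfolding T_def A_def using q
        by (intro nn_integral_mono epowr_mono ennreal_abs_commutator_le[OF b K g]) auto
      also have "\<dots> = (\<integral>\<^sup>+x. ennreal (A powr q) * epowr (biriesz a1 a2 (\<lambda>y. ennreal \<bar>g y\<bar>) x) q \<partial>lborel)"
        using q A by (simp add: epowr_mult epowr_ennreal)
      also have "\<dots> = ennreal (A powr q) * (\<integral>\<^sup>+x. epowr (biriesz a1 a2 (\<lambda>y. ennreal \<bar>g y\<bar>) x) q \<partial>lborel)"
        using g by (intro nn_integral_cmult borel_measurable_epowr)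
          (auto intro!: borel_measurable_biriesz)
      also have "\<dots> \<le> ennreal (A powr q) * (ennreal C * epowr (ennreal I) (q / p))"
        using C(2)[of "\<lambda>y. ennreal \<bar>g y\<bar>"] g gI by (intro mult_left_mono) auto
      also have "\<dots> = ennreal (A powr q * (C * I powr (q / p)))"
        using C(1) I by (simp add: epowr_ennreal ennreal_mult)
      finally show ?thesis .
    qed
    have int: "integrable lebesgue (\<lambda>x. \<bar>T x\<bar> powr q)"
    proof (intro integrableI_bounded)
      show "(\<lambda>x. \<bar>T x\<bar> powr q) \<in> borel_measurable lebesgue"
        using Tm by (intro measurable_completion) auto
      show "(\<integral>\<^sup>+x. ennreal (norm (\<bar>T x\<bar> powr q)) \<partial>lebesgue) < \<infinity>"
        using order_le_less_trans[OF bound ennreal_less_top] by simp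
    qed
    show "commutator b K f \<in> Lp_space q"
      unfolding T Lp_space_def using int Tm by (auto intro: measurable_completion)
    have "ennreal (LINT x|lebesgue. \<bar>T x\<bar> powr q) \<le> ennreal (A powr q * (C * I powr (q / p)))"
      using bound nn_integral_eq_integral[OF int] by simp
    then have "(LINT x|lebesgue. \<bar>T x\<bar> powr q) \<le> A powr q * (C * I powr (q / p))"
      using C(1) by (subst (asm) ennreal_le_iff) auto
    then have "Lp_norm q T \<le> (A powr q * (C * I powr (q / p))) powr (1 / q)"
      unfolding Lp_norm_def using q by (intro powr_mono2) auto
    also have "\<dots> = C powr (1 / q) * A * Lp_norm p f"
      using q A C(1) I by (simp add: powr_mult powr_powr Lp_norm_def I_def[symmetric])
    also have "\<dots> = C powr (1 / q) * kernel_norm K e1 e2 * lip_norm b a1 a2 * Lp_norm p f"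
      by (simp add: A_def)
    finally show "Lp_norm q (commutator b K f)
      \<le> C powr (1 / q) * kernel_norm K e1 e2 * lip_norm b a1 a2 * Lp_norm p f"
      unfolding T .
  qed
qed

end
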